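(* For every integer $d\ge3$ and every $C_1>0$ there exist constants $C_2>0$ and $c>0$, depending only on $d$ and $C_1$, such that for every integer $N\ge1$ and every set $\mathcal P_N\subset[0,1]^d$ of exactly $N$ points, if the discrepancy function $D_N$ of $\mathcal P_N$ satisfies $$\|D_N\|_1\le C_1\sqrt{\log N},$$ then $$\|D_N\|_2\ge c\,N^{C_2}.$$
   Context: For a set $\mathcal P_N\subset[0,1]^d$ of cardinality $N$, its discrepancy function is $$D_N(x)=\sharp(\mathcal P_N\cap[0,x))-N\,|[0,x)|,\qquad x=(x_1,\dots,x_d)\in[0,1]^d,$$ where $[0,x)=\prod_{j=1}^d[0,x_j)$ and $|\cdot|$ is $d$-dimensional Lebesgue measure. $\|\cdot\|_p$ denotes the norm of $L^p([0,1]^d)$ with respect to Lebesgue measure. *)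

theory Defs
  imports "HOL-Analysis.Analysis"
begin

definition half_open_box :: "real ^ 'n \<Rightarrow> (real ^ 'n) set" where
  "half_open_box x = {y. \<forall>j. 0 \<le> y $ j \<and> y $ j < x $ j}"

definition discrepancy :: "(real ^ 'n) set \<Rightarrow> real ^ 'n \<Rightarrow> real" where
  "discrepancy P x =
     real (card (P \<inter> half_open_box x)) - real (card P) * measure lebesgue (half_open_box x)"

text \<open>
  The vectors \<open>0\<close> and \<open>1\<close> are constant, so \<open>cbox 0 1\<close> is the unit cube. The Bochner integral
  is \<open>0\<close> on non-integrable functions; the discrepancy function of a finite set is
  bounded and Borel measurable on the cube, so this convention does not affect it.
\<close>

definition Lp_norm_cube :: "real \<Rightarrow> (real ^ 'n \<Rightarrow> real) \<Rightarrow> real" where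
  "Lp_norm_cube p f = (LINT x:cbox 0 1|lebesgue. \<bar>f x\<bar> powr p) powr (1 / p)"

end

theory Submission
  imports Defs
begin

text \<open>
  Fix three coordinates. For a dyadic box shape \<open>(a, b, c)\<close> with \<open>2 ^ (a + b + c)\<close> comparable to \<open>N\<close>, the
  Haar-type function that vanishes on all boxes meeting the point set has inner product bounded
  below with \<open>D\<close>, by Roth's argument. Group these functions into blocks: for a constant \<open>K\<close>, the
  \<open>j\<close>-th block consists of the \<open>K\<^sup>2\<close> shapes with \<open>a\<close> in the \<open>j\<close>-th interval of length \<open>K\<close> from
  below and \<open>c\<close> in the \<open>j\<close>-th such interval from above. This takes about \<open>J = log N / K\<close> blocks, hence
  \<open>K log N\<close> functions, more than the \<open>log N\<close> that are available in dimension two. Let \<open>F j\<close> be the sum over the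
  \<open>j\<close>-th block and test \<open>D\<close> against the imaginary part \<open>\<Psi>\<close> of Halasz's product
  \<open>\<Prod>j. 1 + \<i> F j / sqrt (K\<^sup>2 J)\<close>. The linear terms contribute a multiple of \<open>sqrt (K log N)\<close>. The terms
  of higher order contribute \<open>O(1)\<close>, because levels of different blocks differ in both the first and
  the third coordinate. Finally \<open>\<bar>\<Psi>\<bar>\<close> is at most \<open>exp (\<Sum>j. (F j)\<^sup>2 / (2 K\<^sup>2 J))\<close>, which is at most \<open>e\<close> outside a set of measure
  exponentially small in \<open>log N\<close>, as the off-diagonal terms of \<open>\<Sum>j. (F j)\<^sup>2\<close> are sums of
  martingale differences. If the \<open>L\<^sup>1\<close> norm is at most \<open>C1 sqrt (log N)\<close> and \<open>K\<close> is large, only the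
  exceptional set can account for the linear terms, and there Cauchy-Schwarz forces the \<open>L\<^sup>2\<close> norm
  to be a power of \<open>N\<close>.
\<close>

section \<open>Flips of binary digits\<close>

text \<open>The binary digit of \<open>t\<close> of weight \<open>1 / 2 ^ (a + 1)\<close>, read as a
  sign: \<open>1\<close> on the left half and \<open>-1\<close> on the right half of each dyadic
  interval of length \<open>1 / 2 ^ a\<close>, as for a Haar function.\<close>

definition rademacher :: "nat \<Rightarrow> real \<Rightarrow> real" where
  "rademacher a t = (if even \<lfloor>2 ^ (a + 1) * t\<rfloor> then 1 else -1)"

text \<open>Swaps the two halves of each dyadic interval of length \<open>1 / 2 ^ a\<close> by
  translation.\<close>

definition digit_flip :: "nat \<Rightarrow> real \<Rightarrow> real" where
  "digit_flip a t = t + rademacher a t / 2 ^ (a + 1)"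

lemma abs_rademacher [simp]: "\<bar>rademacher a t\<bar> = 1"
  by (simp add: rademacher_def)

lemma floor_power2_coarsen:
  fixes t :: real
  assumes "k \<le> m"
  shows "\<lfloor>2 ^ k * t\<rfloor> = \<lfloor>2 ^ m * t\<rfloor> div 2 ^ (m - k)"
proof -
  have "2 ^ k * t = 2 ^ m * t / real_of_int (2 ^ (m - k))"
    using assms by (simp add: field_simps flip: power_add)
  then show ?thesis
    using floor_divide_real_eq_div[of "2 ^ (m - k)" "2 ^ m * t"] by simp
qed

lemma floor_digit_flip:
  "\<lfloor>2 ^ (a + 1) * digit_flip a t\<rfloor> =
     \<lfloor>2 ^ (a + 1) * t\<rfloor> + (if even \<lfloor>2 ^ (a + 1) * t\<rfloor> then 1 else -1)"
proof -
  have "2 ^ (a + 1) * digit_flip a t = 2 ^ (a + 1) * t + rademacher a t"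
    by (simp add: digit_flip_def distrib_left)
  then show ?thesis
    by (cases "even \<lfloor>2 ^ (a + 1) * t\<rfloor>") (simp_all add: rademacher_def)
qed

text \<open>A flip moves the floor at level \<open>a + 1\<close> only within a pair
  \<open>2 * n\<close>, \<open>2 * n + 1\<close>, and every coarser floor is an integer quotient of
  the half of that number.\<close>

lemma floor_digit_flip_coarse:
  assumes "k \<le> a"
  shows "\<lfloor>2 ^ k * digit_flip a t\<rfloor> = \<lfloor>2 ^ k * t\<rfloor>"
proof -
  let ?m = "\<lfloor>2 ^ (a + 1) * t\<rfloor>"
  have eq: "\<lfloor>2 ^ k * s\<rfloor> = \<lfloor>2 ^ (a + 1) * s\<rfloor> div 2 div 2 ^ (a - k)" for s :: real
  proof -
    have "\<lfloor>2 ^ k * s\<rfloor> = \<lfloor>2 ^ (a + 1) * s\<rfloor> div 2 ^ (a + 1 - k)"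
      using assms by (intro floor_power2_coarsen) simp
    also have "(2::int) ^ (a + 1 - k) = 2 * 2 ^ (a - k)"
      using assms by (simp add: Suc_diff_le)
    finally show ?thesis
      by (simp add: zdiv_zmult2_eq)
  qed
  have "\<lfloor>2 ^ (a + 1) * digit_flip a t\<rfloor> div 2 = ?m div 2"
    unfolding floor_digit_flip by (cases "even ?m") (auto elim!: oddE evenE)
  then show ?thesis
    by (simp only: eq)
qed

lemma rademacher_digit_flip: "rademacher a (digit_flip a t) = - rademacher a t"
  unfolding rademacher_def floor_digit_flip by simp

lemma rademacher_digit_flip_coarse:
  assumes "k < a"
  shows "rademacher k (digit_flip a t) = rademacher k t"
proof -
  have "\<lfloor>2 ^ (k + 1) * digit_flip a t\<rfloor> = \<lfloor>2 ^ (k + 1) * t\<rfloor>"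
    using assms by (intro floor_digit_flip_coarse) simp
  then show ?thesis
    by (simp only: rademacher_def)
qed

text \<open>Once \<open>p\<close> and \<open>t\<close> lie in different dyadic intervals of length
  \<open>1 / 2 ^ a\<close>, their order is that of the intervals, and the flip keeps
  \<open>t\<close> in its interval.\<close>

lemma step_digit_flip_eq:
  assumes "\<lfloor>2 ^ a * p\<rfloor> \<noteq> \<lfloor>2 ^ a * t\<rfloor>"
  shows "p < digit_flip a t \<longleftrightarrow> p < t"
proof -
  have *: "p < s \<longleftrightarrow> \<lfloor>2 ^ a * p\<rfloor> < \<lfloor>2 ^ a * s\<rfloor>" if "\<lfloor>2 ^ a * p\<rfloor> \<noteq> \<lfloor>2 ^ a * s\<rfloor>" for s
  proof
    assume "p < s"
    then have "\<lfloor>2 ^ a * p\<rfloor> \<le> \<lfloor>2 ^ a * s\<rfloor>" by (intro floor_mono) simp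
    with that show "\<lfloor>2 ^ a * p\<rfloor> < \<lfloor>2 ^ a * s\<rfloor>" by simp
  next
    assume "\<lfloor>2 ^ a * p\<rfloor> < \<lfloor>2 ^ a * s\<rfloor>"
    then have "2 ^ a * p < 2 ^ a * s" by (meson floor_mono not_less)
    then show "p < s" by simp
  qed
  show ?thesis
    using *[of t] *[of "digit_flip a t"] assms by (simp add: floor_digit_flip_coarse)
qed

lemma borel_measurable_rademacher [measurable]: "rademacher a \<in> borel_measurable borel"
  unfolding rademacher_def by measurable

lemma borel_measurable_digit_flip [measurable]: "digit_flip a \<in> borel_measurable borel"
  unfolding digit_flip_def by measurable

definition flip :: "'n \<Rightarrow> nat \<Rightarrow> real ^ 'n \<Rightarrow> real ^ 'n" where
  "flip i a x = (\<chi> k. if k = i then digit_flip a (x $ k) else x $ k)"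

lemma flip_nth: "flip i a x $ k = (if k = i then digit_flip a (x $ k) else x $ k)"
  by (simp add: flip_def)

lemma flip_eq: "flip i a x = x + axis i (rademacher a (x $ i) / 2 ^ (a + 1))"
  by (simp add: vec_eq_iff flip_nth digit_flip_def axis_def)

lemma borel_measurable_vec_nth [measurable]:
  "(\<lambda>x :: real ^ 'n::finite. x $ i) \<in> borel_measurable borel"
  by (intro borel_measurable_continuous_onI continuous_intros)

lemma borel_measurable_flip [measurable]:
  "(flip i a :: real ^ 'n::finite \<Rightarrow> _) \<in> borel \<rightarrow>\<^sub>M borel"
proof -
  have "flip i a = (\<lambda>x :: real ^ 'n. x + (rademacher a (x $ i) / 2 ^ (a + 1)) *\<^sub>R axis i 1)"
    by (auto simp: flip_eq vec_eq_iff axis_def)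
  then show ?thesis by simp
qed

text \<open>A digit flip is translation by a fixed vector on one half of space and by its negative on
  the other half, and it exchanges the two halves.\<close>

lemma distr_flip_lborel:
  "distr lborel borel (flip i a) = (lborel :: (real ^ 'n::finite) measure)"
proof (rule measure_eqI)
  fix B :: "(real ^ 'n) set"
  assume "B \<in> sets (distr lborel borel (flip i a))"
  then have B [measurable]: "B \<in> sets borel" by simp
  define v :: "real ^ 'n" where "v = axis i (1 / 2 ^ (a + 1))"
  define U :: "(real ^ 'n) set" where "U = {x. rademacher a (x $ i) = 1}"
  have U [measurable]: "U \<in> sets borel" unfolding U_def by measurable
  have translate: "emeasure lborel ((\<lambda>x. w + x) -` S) = emeasure lborel S"
    if "S \<in> sets borel" for w :: "real ^ 'n" and S
  proof -
    have "emeasure lborel S = emeasure (distr lborel borel ((+) w)) S"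
      by (simp add: lborel_distr_plus)
    also have "\<dots> = emeasure lborel ((\<lambda>x. w + x) -` S)"
      using that by (subst emeasure_distr) auto
    finally show ?thesis by simp
  qed
  have shift: "(\<lambda>x. w + x) -` S \<in> sets lborel" if "S \<in> sets borel" for w :: "real ^ 'n" and S
    using measurable_sets_borel[of "(\<lambda>x. w + x)" borel S] that by simp
  have r: "rademacher a t = 1 \<or> rademacher a t = - 1" for t
    by (simp add: rademacher_def)
  have fl: "flip i a x = (if x \<in> U then v + x else - v + x)" for x
    using r[of "x $ i"] by (auto simp: flip_eq U_def v_def axis_def vec_eq_iff)
  have flU: "flip i a x \<in> U \<longleftrightarrow> x \<notin> U" for x
    using r[of "x $ i"] by (auto simp: U_def flip_nth rademacher_digit_flip)
  have 1: "x \<in> U \<longleftrightarrow> v + x \<notin> U" for x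
    using fl[of x] fl[of "v + x"] flU[of x] flU[of "v + x"]
    by (cases "x \<in> U"; cases "v + x \<in> U") simp_all
  have 2: "x \<notin> U \<longleftrightarrow> - v + x \<in> U" for x
    using 1[of "- v + x"] by simp
  \<comment> \<open>The preimage is split by the half in which the image falls: images outside
    \<open>U\<close> arise by translation by \<open>v\<close>, images in \<open>U\<close> by
    translation by \<open>- v\<close>. Translation invariance then applies to each piece.\<close>
  have split: "flip i a -` B = ((\<lambda>x. v + x) -` (B - U)) \<union> ((\<lambda>x. - v + x) -` (B \<inter> U))"
    (is "_ = ?V \<union> ?W")
  proof (rule set_eqI)
    fix x show "x \<in> flip i a -` B \<longleftrightarrow> x \<in> ?V \<union> ?W"
      using 1[of x] 2[of x] fl[of x] by (cases "x \<in> U") simp_all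
  qed
  have disj: "?V \<inter> ?W = {}"
    using 1 2 by blast
  have "emeasure (distr lborel borel (flip i a)) B = emeasure lborel (flip i a -` B)"
    by (subst emeasure_distr) auto
  also have "\<dots> = emeasure lborel ?V + emeasure lborel ?W"
    unfolding split
    by (rule plus_emeasure[symmetric, OF shift shift disj]) auto
  also have "\<dots> = emeasure lborel (B - U) + emeasure lborel (B \<inter> U)"
    by (simp only: translate B U sets.Diff sets.Int)
  also have "\<dots> = emeasure lborel ((B - U) \<union> (B \<inter> U))"
    by (rule plus_emeasure) auto
  also have "(B - U) \<union> (B \<inter> U) = B" by auto
  finally show "emeasure (distr lborel borel (flip i a)) B = emeasure lborel B" .
qed simp

section \<open>Lebesgue measure on the half-open unit cube\<close>

definition unit_cube :: "(real ^ 'n::finite) set" where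
  "unit_cube = {x. \<forall>i. 0 \<le> x $ i \<and> x $ i < 1}"

definition cube_measure :: "(real ^ 'n::finite) measure" where
  "cube_measure = density lborel (indicator unit_cube)"

lemma unit_cube_borel [measurable]: "unit_cube \<in> sets borel"
  unfolding unit_cube_def by measurable

lemma sets_cube_measure [measurable_cong, simp]: "sets cube_measure = sets borel"
  by (simp add: cube_measure_def)

lemma space_cube_measure [simp]: "space cube_measure = UNIV"
  by (simp add: cube_measure_def)

text \<open>Membership says that every coordinate has floor 0, and no flip changes that floor. This
  is why the cube is half-open: flipping a digit of the coordinate 1 would leave the closed
  cube.\<close>

lemma flip_in_unit_cube: "flip i a x \<in> unit_cube \<longleftrightarrow> x \<in> unit_cube"
proof -
  have "(0 \<le> s \<and> s < 1) \<longleftrightarrow> \<lfloor>s\<rfloor> = 0" for s :: real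
    by (auto simp: floor_eq_iff)
  then have "0 \<le> digit_flip a t \<and> digit_flip a t < 1 \<longleftrightarrow> 0 \<le> t \<and> t < 1" for t
    using floor_digit_flip_coarse[of 0 a t] by simp
  then show ?thesis
    by (auto simp: unit_cube_def flip_nth)
qed

lemma AE_cube_measure: "AE x in cube_measure. x \<in> unit_cube"
  unfolding cube_measure_def by (subst AE_density) (auto simp: indicator_def)

lemma emeasure_cube_measure:
  assumes "A \<in> sets borel"
  shows "emeasure cube_measure A = emeasure lborel (unit_cube \<inter> A)"
proof -
  have "emeasure cube_measure A = (\<integral>\<^sup>+x. indicator unit_cube x * indicator A x \<partial>lborel)"
    unfolding cube_measure_def using assms by (intro emeasure_density) simp_all
  also have "\<dots> = (\<integral>\<^sup>+x. indicator (unit_cube \<inter> A) x \<partial>lborel)"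
    by (simp only: indicator_inter_arith)
  finally show ?thesis
    using assms by simp
qed

lemma emeasure_lborel_cbox_cart:
  fixes l w :: "'n::finite \<Rightarrow> real"
  assumes "\<And>i. 0 \<le> w i"
  shows "emeasure lborel (cbox (\<chi> i. l i) (\<chi> i. l i + w i) :: (real ^ 'n) set) = ennreal (\<Prod>i\<in>UNIV. w i)"
proof -
  have ne: "cbox (\<chi> i. l i) (\<chi> i. l i + w i) \<noteq> {}"
    using assms by (simp add: interval_ne_empty_cart)
  have "emeasure lborel (cbox (\<chi> i. l i) (\<chi> i. l i + w i) :: (real ^ 'n) set) =
      ennreal (measure lborel (cbox (\<chi> i. l i) (\<chi> i. l i + w i) :: (real ^ 'n) set))"
    by (rule emeasure_eq_ennreal_measure)
      (metis emeasure_lborel_cbox_finite infinity_ennreal_def less_irrefl)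
  also have "\<dots> = ennreal (\<Prod>i\<in>UNIV. w i)"
    using content_cbox_cart[OF ne] by simp
  finally show ?thesis .
qed

lemma emeasure_cube_measure_le:
  fixes l w :: "'n::finite \<Rightarrow> real"
  assumes w: "\<And>i. 0 \<le> w i" and S: "S \<in> sets borel"
    and sub: "\<And>x i. x \<in> S \<Longrightarrow> x \<in> unit_cube \<Longrightarrow> l i \<le> x $ i \<and> x $ i \<le> l i + w i"
  shows "emeasure cube_measure S \<le> ennreal (\<Prod>i\<in>UNIV. w i)"
proof -
  have "emeasure cube_measure S = emeasure lborel (unit_cube \<inter> S)"
    using S by (rule emeasure_cube_measure)
  also have "\<dots> \<le> emeasure lborel (cbox (\<chi> i. l i) (\<chi> i. l i + w i) :: (real ^ 'n) set)"
    using sub by (intro emeasure_mono) (auto simp: mem_box_cart)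
  finally show ?thesis
    using w by (simp add: emeasure_lborel_cbox_cart)
qed

section \<open>Integration over the unit cube\<close>

lemma emeasure_cube_measure_UNIV_le: "emeasure (cube_measure :: (real ^ 'n::finite) measure) UNIV \<le> 1"
proof -
  have "emeasure (cube_measure :: (real ^ 'n) measure) UNIV \<le> ennreal (\<Prod>i\<in>(UNIV :: 'n set). 1)"
    by (rule emeasure_cube_measure_le[where l = "\<lambda>_. 0"]) (auto simp: unit_cube_def less_imp_le)
  then show ?thesis by simp
qed

interpretation cube: finite_measure "cube_measure :: (real ^ 'n::finite) measure"
proof
  show "emeasure cube_measure (space (cube_measure :: (real ^ 'n) measure)) \<noteq> \<infinity>"
    using emeasure_cube_measure_UNIV_le[where 'n = 'n] by (auto simp: top_unique)
qed

lemma measure_cube_UNIV_le: "measure (cube_measure :: (real ^ 'n::finite) measure) UNIV \<le> 1"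
  using emeasure_cube_measure_UNIV_le[where 'n = 'n]
  by (simp add: cube.emeasure_eq_measure ennreal_le_1)

lemma measure_cube_le:
  fixes l w :: "'n::finite \<Rightarrow> real"
  assumes "\<And>i. 0 \<le> w i" "S \<in> sets borel"
    and "\<And>x i. x \<in> S \<Longrightarrow> x \<in> unit_cube \<Longrightarrow> l i \<le> x $ i \<and> x $ i \<le> l i + w i"
  shows "measure cube_measure S \<le> (\<Prod>i\<in>UNIV. w i)"
  using emeasure_cube_measure_le[OF assms] assms(1)
  by (simp add: cube.emeasure_eq_measure prod_nonneg)

lemma distr_flip_cube_measure: "distr cube_measure borel (flip i a) = cube_measure"
proof (rule measure_eqI)
  fix B assume "B \<in> sets (distr cube_measure borel (flip i a))"
  then have B [measurable]: "B \<in> sets borel" by simp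
  have "emeasure (distr cube_measure borel (flip i a)) B = emeasure cube_measure (flip i a -` B)"
    by (subst emeasure_distr) auto
  also have "\<dots> = emeasure lborel (unit_cube \<inter> flip i a -` B)"
    using measurable_sets_borel[OF borel_measurable_flip B] by (intro emeasure_cube_measure) auto
  also have "unit_cube \<inter> flip i a -` B = flip i a -` (unit_cube \<inter> B)"
    by (auto simp: flip_in_unit_cube)
  also have "emeasure lborel \<dots> = emeasure (distr lborel borel (flip i a)) (unit_cube \<inter> B)"
    by (subst emeasure_distr) auto
  also have "\<dots> = emeasure cube_measure B"
    by (simp add: distr_flip_lborel emeasure_cube_measure)
  finally show "emeasure (distr cube_measure borel (flip i a)) B = emeasure cube_measure B" .
qed simp

lemma
  fixes g :: "real ^ 'n::finite \<Rightarrow> real"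
  assumes [measurable]: "g \<in> borel_measurable borel"
  shows integral_flip: "(\<integral>x. g (flip i a x) \<partial>cube_measure) = (\<integral>x. g x \<partial>cube_measure)"
    and integrable_flip: "integrable cube_measure (\<lambda>x. g (flip i a x)) \<longleftrightarrow> integrable cube_measure g"
proof -
  have [measurable]: "flip i a \<in> cube_measure \<rightarrow>\<^sub>M (borel :: (real ^ 'n) measure)" by simp
  show "(\<integral>x. g (flip i a x) \<partial>cube_measure) = (\<integral>x. g x \<partial>cube_measure)"
    using integral_distr[of "flip i a" cube_measure borel g] by (simp add: distr_flip_cube_measure)
  show "integrable cube_measure (\<lambda>x. g (flip i a x)) \<longleftrightarrow> integrable cube_measure g"
    using integrable_distr_eq[of "flip i a" cube_measure borel g] by (simp add: distr_flip_cube_measure)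
qed

lemma integrable_cube_bounded:
  fixes f :: "real ^ 'n::finite \<Rightarrow> real"
  assumes "f \<in> borel_measurable borel" "\<And>x. x \<in> unit_cube \<Longrightarrow> \<bar>f x\<bar> \<le> B"
  shows "integrable cube_measure f"
  using assms AE_cube_measure
  by (intro cube.integrable_const_bound[of _ B]) (auto elim!: eventually_mono)

lemma integral_cube_mono:
  fixes f g :: "real ^ 'n::finite \<Rightarrow> real"
  assumes "integrable cube_measure f" "integrable cube_measure g"
    "\<And>x. x \<in> unit_cube \<Longrightarrow> f x \<le> g x"
  shows "(\<integral>x. f x \<partial>cube_measure) \<le> (\<integral>x. g x \<partial>cube_measure)"
  using assms AE_cube_measure
  by (intro integral_mono_AE) (auto elim!: eventually_mono)

text \<open>The substitution \<open>flip i a\<close> turns the integral of \<open>g * h\<close> into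
  minus that of \<open>g\<close> times the flipped \<open>h\<close>; averaging the two forms
  replaces \<open>h\<close> by a difference. This plays the part of integration by parts.\<close>

lemma integral_flip_antisymmetric:
  fixes g h :: "real ^ 'n::finite \<Rightarrow> real"
  assumes [measurable]: "g \<in> borel_measurable borel" "h \<in> borel_measurable borel"
    and anti: "\<And>x. g (flip i a x) = - g x"
    and int: "integrable cube_measure (\<lambda>x. g x * h x)"
  shows "(\<integral>x. g x * h x \<partial>cube_measure) = (\<integral>x. g x * (h x - h (flip i a x)) \<partial>cube_measure) / 2"
    and "integrable cube_measure (\<lambda>x. g x * (h x - h (flip i a x)))"
proof -
  have int': "integrable cube_measure (\<lambda>x. g x * h (flip i a x))"
    using integrable_flip[of "\<lambda>x. g x * h x" i a] int by (simp add: anti)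
  have "(\<integral>x. g x * h x \<partial>cube_measure) = - (\<integral>x. g x * h (flip i a x) \<partial>cube_measure)"
    using integral_flip[of "\<lambda>x. g x * h x" i a] by (simp add: anti)
  moreover have "(\<integral>x. g x * (h x - h (flip i a x)) \<partial>cube_measure) =
      (\<integral>x. g x * h x \<partial>cube_measure) - (\<integral>x. g x * h (flip i a x) \<partial>cube_measure)"
    using int int' by (simp add: right_diff_distrib)
  ultimately show "(\<integral>x. g x * h x \<partial>cube_measure) =
      (\<integral>x. g x * (h x - h (flip i a x)) \<partial>cube_measure) / 2"
    by simp
  show "integrable cube_measure (\<lambda>x. g x * (h x - h (flip i a x)))"
    using int int' by (simp add: right_diff_distrib)
qed

section \<open>Products of functions of single coordinates\<close>

definition coord_prod :: "('n::finite \<Rightarrow> real \<Rightarrow> real) \<Rightarrow> real ^ 'n \<Rightarrow> real" where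
  "coord_prod u x = (\<Prod>i\<in>UNIV. u i (x $ i))"

definition flip_diff :: "nat \<Rightarrow> (real \<Rightarrow> real) \<Rightarrow> real \<Rightarrow> real" where
  "flip_diff a v t = v t - v (digit_flip a t)"

lemma borel_measurable_coord_prod:
  "(\<And>i. u i \<in> borel_measurable borel) \<Longrightarrow> coord_prod u \<in> borel_measurable borel"
  unfolding coord_prod_def by (intro borel_measurable_prod) simp

lemma borel_measurable_flip_diff:
  "v \<in> borel_measurable borel \<Longrightarrow> flip_diff a v \<in> borel_measurable borel"
  using measurable_compose[OF borel_measurable_digit_flip]
  unfolding flip_diff_def by (intro borel_measurable_diff) auto

lemma coord_prod_flip_diff:
  "coord_prod u x - coord_prod u (flip i a x) = coord_prod (u(i := flip_diff a (u i))) x"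
proof -
  have "coord_prod u x = u i (x $ i) * (\<Prod>k\<in>UNIV - {i}. u k (x $ k))"
    by (simp add: coord_prod_def prod.remove[of UNIV i])
  moreover have "coord_prod u (flip i a x) =
      u i (digit_flip a (x $ i)) * (\<Prod>k\<in>UNIV - {i}. u k (x $ k))"
    by (simp add: coord_prod_def prod.remove[of UNIV i] flip_nth)
  moreover have "coord_prod (u(i := flip_diff a (u i))) x =
      flip_diff a (u i) (x $ i) * (\<Prod>k\<in>UNIV - {i}. u k (x $ k))"
    by (simp add: coord_prod_def prod.remove[of UNIV i])
  ultimately show ?thesis
    by (simp add: flip_diff_def algebra_simps)
qed

text \<open>A flip in coordinate \<open>i\<close> touches only the factor \<open>u i\<close>. The
  last two conclusions restore the hypotheses for \<open>u'\<close>, so the lemma can be iterated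
  over several coordinates, each one costing a factor 1/2.\<close>

lemma integral_coord_prod_antisymmetric:
  fixes g :: "real ^ 'n::finite \<Rightarrow> real"
  assumes g: "g \<in> borel_measurable borel" and u: "\<And>k. u k \<in> borel_measurable borel"
    and anti: "\<And>x. g (flip i a x) = - g x"
    and int: "integrable cube_measure (\<lambda>x. g x * coord_prod u x)"
  defines "u' \<equiv> u(i := flip_diff a (u i))"
  shows "(\<integral>x. g x * coord_prod u x \<partial>cube_measure) =
      (\<integral>x. g x * coord_prod u' x \<partial>cube_measure) / 2"
    and "integrable cube_measure (\<lambda>x. g x * coord_prod u' x)"
    and "\<And>k. u' k \<in> borel_measurable borel"
  using integral_flip_antisymmetric[OF g borel_measurable_coord_prod[OF u] anti int]
    borel_measurable_flip_diff[OF u] u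
  by (simp_all add: coord_prod_flip_diff u'_def)

section \<open>Volumes of dyadic slabs\<close>

lemma prod_UNIV_split2:
  fixes f :: "'n::finite \<Rightarrow> real"
  assumes "i \<noteq> j"
  shows "prod f UNIV = f i * f j * prod f (UNIV - {i, j})"
  using assms by (simp add: prod.remove[of UNIV i] prod.remove[of "UNIV - {i}" j] Diff_insert2[symmetric]
    insert_commute mult.assoc)

lemma prod_UNIV_split3:
  fixes f :: "'n::finite \<Rightarrow> real"
  assumes "distinct [i, j, k]"
  shows "prod f UNIV = f i * f j * f k * prod f (UNIV - {i, j, k})"
proof -
  have "prod f (UNIV - {i, j}) = f k * prod f (UNIV - {i, j} - {k})"
    using assms by (intro prod.remove) auto
  also have "UNIV - {i, j} - {k} = UNIV - {i, j, k}" by auto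
  finally show ?thesis
    using prod_UNIV_split2[of i j f] assms by (simp add: mult.assoc)
qed

lemma same_floor_power2_bounds:
  fixes t p :: real
  assumes "\<lfloor>2 ^ a * t\<rfloor> = \<lfloor>2 ^ a * p\<rfloor>"
  shows "\<lfloor>2 ^ a * p\<rfloor> / 2 ^ a \<le> t" "t \<le> \<lfloor>2 ^ a * p\<rfloor> / 2 ^ a + 1 / 2 ^ a"
proof -
  have "of_int \<lfloor>2 ^ a * p\<rfloor> \<le> 2 ^ a * t" "2 ^ a * t \<le> of_int \<lfloor>2 ^ a * p\<rfloor> + 1"
    using assms by linarith+
  then show "\<lfloor>2 ^ a * p\<rfloor> / 2 ^ a \<le> t" "t \<le> \<lfloor>2 ^ a * p\<rfloor> / 2 ^ a + 1 / 2 ^ a"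
    by (simp_all add: field_simps)
qed

text \<open>Within the cube the slab lies in a box with sides \<open>1 / 2 ^ a\<close> and
  \<open>1 / 2 ^ c\<close>, the others being 1. It is only an inequality because \<open>p\<close>
  may lie outside the half-open cube, as a point with a coordinate 1 does.\<close>

lemma measure_dyadic_slab2_le:
  fixes p :: "real ^ 'n::finite"
  assumes "i \<noteq> j"
  shows "measure cube_measure {x :: real ^ 'n. \<lfloor>2 ^ a * x $ i\<rfloor> = \<lfloor>2 ^ a * p $ i\<rfloor> \<and>
      \<lfloor>2 ^ c * x $ j\<rfloor> = \<lfloor>2 ^ c * p $ j\<rfloor>} \<le> 1 / 2 ^ (a + c)" (is "measure _ ?S \<le> _")
proof -
  define w :: "'n \<Rightarrow> real" where "w = (\<lambda>_. 1)(i := 1 / 2 ^ a, j := 1 / 2 ^ c)"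
  define l :: "'n \<Rightarrow> real" where
    "l = (\<lambda>_. 0)(i := \<lfloor>2 ^ a * p $ i\<rfloor> / 2 ^ a, j := \<lfloor>2 ^ c * p $ j\<rfloor> / 2 ^ c)"
  have "measure cube_measure ?S \<le> (\<Prod>k\<in>UNIV. w k)"
  proof (rule measure_cube_le[where l = l])
    show "?S \<in> sets borel" by measurable
    show "0 \<le> w k" for k by (simp add: w_def)
    fix x k assume "x \<in> ?S" "x \<in> unit_cube"
    then show "l k \<le> x $ k \<and> x $ k \<le> l k + w k"
      using same_floor_power2_bounds[of a "x $ i" "p $ i"] same_floor_power2_bounds[of c "x $ j" "p $ j"] assms
      by (auto simp: l_def w_def unit_cube_def less_imp_le)
  qed
  also have "\<dots> = 1 / 2 ^ (a + c)"
    using assms by (subst prod_UNIV_split2[OF assms]) (simp add: w_def power_add)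
  finally show ?thesis .
qed

lemma measure_dyadic_slab3_le:
  fixes p :: "real ^ 'n::finite"
  assumes "distinct [i, j, k]"
  shows "measure cube_measure {x :: real ^ 'n. \<lfloor>2 ^ a * x $ i\<rfloor> = \<lfloor>2 ^ a * p $ i\<rfloor> \<and>
      \<lfloor>2 ^ b * x $ j\<rfloor> = \<lfloor>2 ^ b * p $ j\<rfloor> \<and> \<lfloor>2 ^ c * x $ k\<rfloor> = \<lfloor>2 ^ c * p $ k\<rfloor>}
      \<le> 1 / 2 ^ (a + b + c)" (is "measure _ ?S \<le> _")
proof -
  define w :: "'n \<Rightarrow> real" where "w = (\<lambda>_. 1)(i := 1 / 2 ^ a, j := 1 / 2 ^ b, k := 1 / 2 ^ c)"
  define l :: "'n \<Rightarrow> real" where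
    "l = (\<lambda>_. 0)(i := \<lfloor>2 ^ a * p $ i\<rfloor> / 2 ^ a, j := \<lfloor>2 ^ b * p $ j\<rfloor> / 2 ^ b,
      k := \<lfloor>2 ^ c * p $ k\<rfloor> / 2 ^ c)"
  have "measure cube_measure ?S \<le> (\<Prod>k\<in>UNIV. w k)"
  proof (rule measure_cube_le[where l = l])
    show "?S \<in> sets borel" by measurable
    show "0 \<le> w k" for k by (simp add: w_def)
    fix x m assume "x \<in> ?S" "x \<in> unit_cube"
    then show "l m \<le> x $ m \<and> x $ m \<le> l m + w m"
      using same_floor_power2_bounds[of a "x $ i" "p $ i"] same_floor_power2_bounds[of b "x $ j" "p $ j"]
        same_floor_power2_bounds[of c "x $ k" "p $ k"] assms
      by (auto simp: l_def w_def unit_cube_def less_imp_le)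
  qed
  also have "\<dots> = 1 / 2 ^ (a + b + c)"
    using assms by (subst prod_UNIV_split3[OF assms]) (simp add: w_def power_add)
  finally show ?thesis .
qed

section \<open>The discrepancy function against antisymmetric functions\<close>

text \<open>A combination of coordinate products, so that flips act on one factor at a time. It
  agrees with \<open>discrepancy\<close> on the closed cube, but may differ from it
  elsewhere.\<close>

definition cube_discrepancy :: "(real ^ 'n::finite) set \<Rightarrow> real ^ 'n \<Rightarrow> real" where
  "cube_discrepancy P x = (\<Sum>p\<in>P. coord_prod (\<lambda>i t. of_bool (p $ i < t)) x)
     - real (card P) * coord_prod (\<lambda>_ t. t) x"

lemma discrepancy_eq_cube_discrepancy:
  fixes P :: "(real ^ 'n::finite) set"
  assumes "finite P" "P \<subseteq> cbox 0 1" "x \<in> cbox 0 1"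
  shows "discrepancy P x = cube_discrepancy P x"
proof -
  have P0: "0 \<le> p $ i" if "p \<in> P" for p i
    using that assms(2) by (auto simp: mem_box_cart)
  have x0: "0 \<le> x $ i" for i
    using assms(3) by (auto simp: mem_box_cart)
  have step: "coord_prod (\<lambda>i t. of_bool (p $ i < t)) x = of_bool (\<forall>i. p $ i < x $ i)"
    for p :: "real ^ 'n"
    by (auto simp: coord_prod_def)
  have "P \<inter> half_open_box x = {p \<in> P. \<forall>i. p $ i < x $ i}"
    using P0 by (auto simp: half_open_box_def)
  then have "real (card (P \<inter> half_open_box x)) =
      (\<Sum>p\<in>P. coord_prod (\<lambda>i t. of_bool (p $ i < t)) x)"
    using assms(1) by (simp only: step) (simp add: of_bool_def sum.If_cases Int_def)
  moreover have "measure lebesgue (half_open_box x) = coord_prod (\<lambda>_ t. t) x"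
  proof -
    have bor [measurable]: "half_open_box x \<in> sets borel"
      unfolding half_open_box_def by measurable
    have "emeasure lborel (cbox 0 x) = ennreal (coord_prod (\<lambda>_ t. t) x)"
      using emeasure_lborel_cbox_cart[of "\<lambda>i. x $ i" "\<lambda>_. 0"] x0
      by (simp add: coord_prod_def zero_vec_def[symmetric])
    moreover have "emeasure lborel (box 0 x) = emeasure lborel (cbox 0 x)"
      by (simp only: emeasure_lborel_box_eq emeasure_lborel_cbox_eq)
    moreover have "emeasure lborel (box 0 x) \<le> emeasure lborel (half_open_box x)"
      by (intro emeasure_mono) (auto simp: mem_box_cart half_open_box_def less_imp_le)
    moreover have "emeasure lborel (half_open_box x) \<le> emeasure lborel (cbox 0 x)"
      by (intro emeasure_mono) (auto simp: mem_box_cart half_open_box_def less_imp_le)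
    ultimately have "emeasure lborel (half_open_box x) = ennreal (coord_prod (\<lambda>_ t. t) x)"
      by order
    then show ?thesis
      using x0 by (simp add: measure_def coord_prod_def prod_nonneg)
  qed
  ultimately show ?thesis
    by (simp add: discrepancy_def cube_discrepancy_def)
qed

lemma unit_cube_subset_cbox: "unit_cube \<subseteq> cbox 0 1"
  by (auto simp: unit_cube_def mem_box_cart less_imp_le)

lemma abs_coord_prod_le_1:
  assumes "\<And>k t. 0 \<le> t \<Longrightarrow> t \<le> 1 \<Longrightarrow> \<bar>u k t\<bar> \<le> 1" "x \<in> cbox 0 1"
  shows "\<bar>coord_prod u x\<bar> \<le> 1"
  unfolding coord_prod_def abs_prod using assms by (intro prod_le_1) (auto simp: mem_box_cart)

lemma borel_measurable_cube_discrepancy [measurable]: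
  "cube_discrepancy P \<in> borel_measurable borel"
  unfolding cube_discrepancy_def coord_prod_def by measurable

lemma abs_cube_discrepancy_le:
  assumes "x \<in> cbox 0 1"
  shows "\<bar>cube_discrepancy P x\<bar> \<le> 2 * real (card P)"
proof -
  have "\<bar>\<Sum>p\<in>P. coord_prod (\<lambda>i t. of_bool (p $ i < t)) x\<bar>
      \<le> (\<Sum>p\<in>P. \<bar>coord_prod (\<lambda>i t. of_bool (p $ i < t)) x\<bar>)"
    by (rule sum_abs)
  also have "\<dots> \<le> (\<Sum>p\<in>P. 1)"
    using assms by (intro sum_mono abs_coord_prod_le_1) auto
  finally have "\<bar>\<Sum>p\<in>P. coord_prod (\<lambda>i t. of_bool (p $ i < t)) x\<bar> \<le> real (card P)"
    by simp
  moreover have "\<bar>real (card P) * coord_prod (\<lambda>_ t. t) x\<bar> \<le> real (card P) * 1"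
    unfolding abs_mult using assms by (intro mult_mono abs_coord_prod_le_1) auto
  ultimately show ?thesis
    unfolding cube_discrepancy_def by linarith
qed

lemma integrable_mult_coord_prod:
  fixes g :: "real ^ 'n::finite \<Rightarrow> real"
  assumes [measurable]: "g \<in> borel_measurable borel" and B: "\<And>x. \<bar>g x\<bar> \<le> B"
    and u: "\<And>k. u k \<in> borel_measurable borel"
    and u1: "\<And>k t. 0 \<le> t \<Longrightarrow> t \<le> 1 \<Longrightarrow> \<bar>u k t\<bar> \<le> 1"
  shows "integrable cube_measure (\<lambda>x. g x * coord_prod u x)"
proof (rule integrable_cube_bounded)
  show "(\<lambda>x. g x * coord_prod u x) \<in> borel_measurable borel"
    using borel_measurable_coord_prod[OF u] by measurable
  fix x :: "real ^ 'n" assume "x \<in> unit_cube"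
  then have "\<bar>g x\<bar> * \<bar>coord_prod u x\<bar> \<le> B * 1"
    using B[of x] u1 unit_cube_subset_cbox by (intro mult_mono abs_coord_prod_le_1) auto
  then show "\<bar>g x * coord_prod u x\<bar> \<le> B"
    by (simp add: abs_mult)
qed

lemma integral_mult_cube_discrepancy:
  fixes g :: "real ^ 'n::finite \<Rightarrow> real"
  assumes g: "g \<in> borel_measurable borel" "\<And>x. \<bar>g x\<bar> \<le> B"
  shows "(\<integral>x. g x * cube_discrepancy P x \<partial>cube_measure) =
    (\<Sum>p\<in>P. \<integral>x. g x * coord_prod (\<lambda>i t. of_bool (p $ i < t)) x \<partial>cube_measure) -
    real (card P) * (\<integral>x. g x * coord_prod (\<lambda>_ t. t) x \<partial>cube_measure)"
proof -
  have 1: "integrable cube_measure (\<lambda>x. g x * coord_prod (\<lambda>i t. of_bool (p $ i < t)) x)" for p :: "real ^ 'n"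
    by (intro integrable_mult_coord_prod[OF g]) auto
  have 2: "integrable cube_measure (\<lambda>x. g x * coord_prod (\<lambda>_ t. t) x)"
    by (intro integrable_mult_coord_prod[OF g]) auto
  have "(\<integral>x. g x * cube_discrepancy P x \<partial>cube_measure) =
    (\<integral>x. (\<Sum>p\<in>P. g x * coord_prod (\<lambda>i t. of_bool (p $ i < t)) x) -
       real (card P) * (g x * coord_prod (\<lambda>_ t. t) x) \<partial>cube_measure)"
    by (simp add: cube_discrepancy_def algebra_simps sum_distrib_left)
  also have "\<dots> = (\<integral>x. (\<Sum>p\<in>P. g x * coord_prod (\<lambda>i t. of_bool (p $ i < t)) x) \<partial>cube_measure) -
      (\<integral>x. real (card P) * (g x * coord_prod (\<lambda>_ t. t) x) \<partial>cube_measure)"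
    using 1 2 by (intro Bochner_Integration.integral_diff) auto
  also have "(\<integral>x. (\<Sum>p\<in>P. g x * coord_prod (\<lambda>i t. of_bool (p $ i < t)) x) \<partial>cube_measure) =
      (\<Sum>p\<in>P. \<integral>x. g x * coord_prod (\<lambda>i t. of_bool (p $ i < t)) x \<partial>cube_measure)"
    using 1 by (intro Bochner_Integration.integral_sum) auto
  finally show ?thesis by simp
qed

lemma flip_diff_step_eq_0:
  "\<lfloor>2 ^ a * t\<rfloor> \<noteq> \<lfloor>2 ^ a * p\<rfloor> \<Longrightarrow> flip_diff a (\<lambda>t. of_bool (p < t)) t = 0"
  using step_digit_flip_eq[of a p t] by (auto simp: flip_diff_def)

lemma abs_flip_diff_step_le: "\<bar>flip_diff a (\<lambda>t. of_bool (p < t)) t\<bar> \<le> 1"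
  by (simp add: flip_diff_def)

lemma flip_diff_ident: "flip_diff a (\<lambda>t. t) t = - rademacher a t / 2 ^ (a + 1)"
  by (simp add: flip_diff_def digit_flip_def)

text \<open>Antisymmetry in two coordinates puts differences in place of two factors. For the
  indicator belonging to a point these differences live on a slab of measure at most
  \<open>1 / 2 ^ (a + c)\<close>; for the volume they are themselves of that size. The bound
  controls the terms of order at least two in the Riesz product.\<close>

lemma abs_integral_antisymmetric2_le:
  fixes g :: "real ^ 'n::finite \<Rightarrow> real"
  assumes fin: "finite P" and ij: "i \<noteq> j"
    and g: "g \<in> borel_measurable borel" "\<And>x. \<bar>g x\<bar> \<le> B"
    and anti: "\<And>x. g (flip i a x) = - g x" "\<And>x. g (flip j c x) = - g x"
  shows "\<bar>\<integral>x. g x * cube_discrepancy P x \<partial>cube_measure\<bar> \<le> B * real (card P) / 2 ^ (a + c)"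
proof -
  have B0: "0 \<le> B" using g(2)[of 0] by linarith
  \<comment> \<open>A common bound for both parts of the discrepancy: for a point, \<open>S\<close>
    is the slab and \<open>\<delta>\<close> is 1; for the volume, \<open>S\<close> is everything and
    \<open>\<delta>\<close> is the size of the double difference.\<close>
  have diff: "\<bar>\<integral>x. g x * coord_prod u x \<partial>cube_measure\<bar> \<le> B * measure cube_measure S * \<delta> / 4"
    if u: "\<And>k. u k \<in> borel_measurable borel"
      and u1: "\<And>k t. 0 \<le> t \<Longrightarrow> t \<le> 1 \<Longrightarrow> \<bar>u k t\<bar> \<le> 1"
      and S: "S \<in> sets borel" and \<delta>: "0 \<le> \<delta>"
      and bd: "\<And>x. x \<in> unit_cube \<Longrightarrow>
        \<bar>coord_prod (u(i := flip_diff a (u i), j := flip_diff c (u j))) x\<bar> \<le> indicator S x * \<delta>"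
    for u :: "'n \<Rightarrow> real \<Rightarrow> real" and S \<delta>
  proof -
    define u1 where "u1 = u(i := flip_diff a (u i))"
    define u2 where "u2 = u1(j := flip_diff c (u1 j))"
    have u2: "u2 = u(i := flip_diff a (u i), j := flip_diff c (u j))"
      using ij by (simp add: u2_def u1_def)
    note 1 = integral_coord_prod_antisymmetric[where u = u, OF g(1) u anti(1)
        integrable_mult_coord_prod[where u = u, OF g u that(2)], folded u1_def]
    note 2 = integral_coord_prod_antisymmetric[where u = u1, OF g(1) 1(3) anti(2) 1(2), folded u2_def]
    have "(\<integral>x. g x * coord_prod u x \<partial>cube_measure) = (\<integral>x. g x * coord_prod u2 x \<partial>cube_measure) / 4"
      using 1(1) 2(1) by simp
    then have "\<bar>\<integral>x. g x * coord_prod u x \<partial>cube_measure\<bar> = \<bar>\<integral>x. g x * coord_prod u2 x \<partial>cube_measure\<bar> / 4"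
      by simp
    also have "\<bar>\<integral>x. g x * coord_prod u2 x \<partial>cube_measure\<bar> \<le> (\<integral>x. \<bar>g x * coord_prod u2 x\<bar> \<partial>cube_measure)"
      by (rule integral_abs_bound)
    also have "\<dots> \<le> (\<integral>x. indicator S x * (B * \<delta>) \<partial>cube_measure)"
    proof (rule integral_cube_mono)
      show "integrable cube_measure (\<lambda>x. \<bar>g x * coord_prod u2 x\<bar>)"
        using 2(2) by simp
      show "integrable cube_measure (\<lambda>x. indicator S x * (B * \<delta>) :: real)"
        using S by (intro integrable_mult_left) (simp add: cube.emeasure_eq_measure less_top)
      fix x :: "real ^ 'n" assume "x \<in> unit_cube"
      then have "\<bar>g x\<bar> * \<bar>coord_prod u2 x\<bar> \<le> B * (indicator S x * \<delta>)"
        unfolding u2 using g(2)[of x] B0 by (intro mult_mono bd) auto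
      then show "\<bar>g x * coord_prod u2 x\<bar> \<le> indicator S x * (B * \<delta>)"
        by (simp add: abs_mult mult_ac)
    qed
    also have "(\<integral>x. indicator S x * (B * \<delta>) \<partial>cube_measure) = B * measure cube_measure S * \<delta>"
      using S by simp
    finally show ?thesis by simp
  qed
  have step: "\<bar>\<integral>x. g x * coord_prod (\<lambda>i t. of_bool (p $ i < t)) x \<partial>cube_measure\<bar>
      \<le> B / 2 ^ (a + c) / 4" for p :: "real ^ 'n"
  proof -
    define S where "S = {x :: real ^ 'n. \<lfloor>2 ^ a * x $ i\<rfloor> = \<lfloor>2 ^ a * p $ i\<rfloor> \<and>
      \<lfloor>2 ^ c * x $ j\<rfloor> = \<lfloor>2 ^ c * p $ j\<rfloor>}"
    define u where "u = (\<lambda>i t. of_bool (p $ i < t) :: real)"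
    define u2 where "u2 = u(i := flip_diff a (u i), j := flip_diff c (u j))"
    have "\<bar>coord_prod u2 x\<bar> \<le> indicator S x * 1" for x
    proof (cases "x \<in> S")
      case True
      have "\<bar>u2 k t\<bar> \<le> 1" for k t
        using abs_flip_diff_step_le by (auto simp: u2_def u_def)
      then show ?thesis
        using True by (simp add: coord_prod_def abs_prod prod_le_1)
    next
      case False
      then have "u2 i (x $ i) = 0 \<or> u2 j (x $ j) = 0"
        using ij by (auto simp: S_def u2_def u_def flip_diff_step_eq_0)
      then have "coord_prod u2 x = 0"
        unfolding coord_prod_def by (metis UNIV_I finite prod_zero)
      then show ?thesis by simp
    qed
    then have "\<bar>\<integral>x. g x * coord_prod u x \<partial>cube_measure\<bar> \<le> B * measure cube_measure S * 1 / 4"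
      unfolding u2_def by (intro diff) (auto simp: u_def S_def)
    also have "\<dots> \<le> B * (1 / 2 ^ (a + c)) / 4"
      using mult_left_mono[OF measure_dyadic_slab2_le[OF ij, of a p c] B0] by (simp add: S_def)
    finally show ?thesis
      by (simp add: u_def)
  qed
  \<comment> \<open>The 16 comes from a factor 1/4 for the two averagings and 1/2 for each of the
    differences \<open>1 / 2 ^ (a + 1)\<close> and \<open>1 / 2 ^ (c + 1)\<close>.\<close>
  have ident: "\<bar>\<integral>x. g x * coord_prod (\<lambda>_ t. t) x \<partial>cube_measure\<bar> \<le> B / 2 ^ (a + c) / 16"
  proof -
    define u :: "'n \<Rightarrow> real \<Rightarrow> real" where "u = (\<lambda>_ t. t)"
    define u2 where "u2 = u(i := flip_diff a (u i), j := flip_diff c (u j))"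
    have "\<bar>coord_prod u2 x\<bar> \<le> 1 / 2 ^ (a + c) / 4" if x: "x \<in> unit_cube" for x
    proof -
      have "coord_prod u2 x = u2 i (x $ i) * u2 j (x $ j) * (\<Prod>k\<in>UNIV - {i, j}. u2 k (x $ k))"
        unfolding coord_prod_def by (rule prod_UNIV_split2[OF ij])
      also have "\<bar>\<dots>\<bar> = (1 / 2 ^ (a + c) / 4) * \<bar>\<Prod>k\<in>UNIV - {i, j}. u2 k (x $ k)\<bar>"
        using ij by (simp add: u2_def u_def flip_diff_ident abs_mult power_add)
      also have "\<dots> \<le> (1 / 2 ^ (a + c) / 4) * 1"
        using x unfolding abs_prod
        by (intro mult_left_mono prod_le_1) (auto simp: u2_def u_def unit_cube_def less_imp_le)
      finally show ?thesis by simp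
    qed
    then have "\<bar>\<integral>x. g x * coord_prod u x \<partial>cube_measure\<bar>
        \<le> B * measure (cube_measure :: (real ^ 'n) measure) UNIV * (1 / 2 ^ (a + c) / 4) / 4"
      unfolding u2_def by (intro diff) (auto simp: u_def)
    also have "\<dots> \<le> B * 1 * (1 / 2 ^ (a + c) / 4) / 4"
      using measure_cube_UNIV_le[where 'n = 'n] B0
      by (intro divide_right_mono mult_right_mono mult_left_mono) auto
    finally show ?thesis
      by (simp add: u_def)
  qed
  let ?N = "real (card P)" and ?A = "\<Sum>p\<in>P. \<integral>x. g x * coord_prod (\<lambda>i t. of_bool (p $ i < t)) x \<partial>cube_measure"
  have "\<bar>?A\<bar> \<le> (\<Sum>p\<in>P. \<bar>\<integral>x. g x * coord_prod (\<lambda>i t. of_bool (p $ i < t)) x \<partial>cube_measure\<bar>)"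
    by (rule sum_abs)
  also have "\<dots> \<le> ?N * (B / 2 ^ (a + c) / 4)"
    using sum_bounded_above[of P _ "B / 2 ^ (a + c) / 4"] step by simp
  finally have 1: "\<bar>?A\<bar> \<le> ?N * (B / 2 ^ (a + c) / 4)" .
  have 2: "\<bar>?N * (\<integral>x. g x * coord_prod (\<lambda>_ t. t) x \<partial>cube_measure)\<bar> \<le> ?N * (B / 2 ^ (a + c) / 16)"
    unfolding abs_mult using ident by (intro mult_mono) auto
  have "\<bar>\<integral>x. g x * cube_discrepancy P x \<partial>cube_measure\<bar> \<le> ?N * (B / 2 ^ (a + c) / 4) + ?N * (B / 2 ^ (a + c) / 16)"
    unfolding integral_mult_cube_discrepancy[OF g]
    by (rule order_trans[OF abs_triangle_ineq4 add_mono[OF 1 2]])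
  also have "\<dots> \<le> B * ?N / 2 ^ (a + c)"
    using B0 by (simp add: field_simps)
  finally show ?thesis .
qed

section \<open>Haar functions vanishing on the boxes that meet the point set\<close>

definition same_cell ::
    "'n::finite \<Rightarrow> 'n \<Rightarrow> 'n \<Rightarrow> nat \<Rightarrow> nat \<Rightarrow> nat \<Rightarrow> real ^ 'n \<Rightarrow> real ^ 'n \<Rightarrow> bool" where
  "same_cell i j k a b c p x \<longleftrightarrow> \<lfloor>2 ^ a * x $ i\<rfloor> = \<lfloor>2 ^ a * p $ i\<rfloor> \<and>
     \<lfloor>2 ^ b * x $ j\<rfloor> = \<lfloor>2 ^ b * p $ j\<rfloor> \<and> \<lfloor>2 ^ c * x $ k\<rfloor> = \<lfloor>2 ^ c * p $ k\<rfloor>"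

text \<open>Summed Haar functions of one dyadic shape in the coordinates \<open>i\<close>,
  \<open>j\<close>, \<open>k\<close>, constant in the others on each cell and set to 0 on the cells
  that meet \<open>P\<close>.\<close>

definition void_haar ::
    "(real ^ 'n::finite) set \<Rightarrow> 'n \<Rightarrow> 'n \<Rightarrow> 'n \<Rightarrow> nat \<Rightarrow> nat \<Rightarrow> nat \<Rightarrow> real ^ 'n \<Rightarrow> real" where
  "void_haar P i j k a b c x = of_bool (\<forall>p\<in>P. \<not> same_cell i j k a b c p x) *
     (rademacher a (x $ i) * rademacher b (x $ j) * rademacher c (x $ k))"

lemma abs_void_haar_le: "\<bar>void_haar P i j k a b c x\<bar> \<le> 1"
  by (simp add: void_haar_def abs_mult)

lemma sets_same_cell [measurable]: "{x. same_cell i j k a b c p x} \<in> sets borel"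
  unfolding same_cell_def by measurable

lemma borel_measurable_void_haar:
  assumes "finite P"
  shows "void_haar P i j k a b c \<in> borel_measurable borel"
proof -
  have "{x. \<forall>p\<in>P. \<not> same_cell i j k a b c p x} = - (\<Union>p\<in>P. {x. same_cell i j k a b c p x})"
    by auto
  also have "\<dots> \<in> sets borel"
    using assms by (intro borel_comp sets.finite_UN) auto
  finally have [measurable]: "Measurable.pred borel (\<lambda>x. \<forall>p\<in>P. \<not> same_cell i j k a b c p x)"
    by (simp add: pred_def)
  show ?thesis
    unfolding void_haar_def by measurable
qed

context
  fixes i j k :: "'n::finite"
  assumes dist: "distinct [i, j, k]"
begin

lemma neq: "i \<noteq> j" "j \<noteq> i" "i \<noteq> k" "k \<noteq> i" "j \<noteq> k" "k \<noteq> j"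
  using dist by auto

lemma void_haar_flip_fst: "void_haar P i j k a b c (flip i a x) = - void_haar P i j k a b c x"
  using neq by (simp add: void_haar_def same_cell_def flip_nth floor_digit_flip_coarse
    rademacher_digit_flip)

lemma void_haar_flip_snd: "void_haar P i j k a b c (flip j b x) = - void_haar P i j k a b c x"
  using neq by (simp add: void_haar_def same_cell_def flip_nth floor_digit_flip_coarse
    rademacher_digit_flip)

lemma void_haar_flip_trd: "void_haar P i j k a b c (flip k c x) = - void_haar P i j k a b c x"
  using neq by (simp add: void_haar_def same_cell_def flip_nth floor_digit_flip_coarse
    rademacher_digit_flip)

lemma void_haar_flip_fst_coarse:
  "a < m \<Longrightarrow> void_haar P i j k a b c (flip i m x) = void_haar P i j k a b c x"
  using neq by (simp add: void_haar_def same_cell_def flip_nth floor_digit_flip_coarse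
    rademacher_digit_flip_coarse)

lemma void_haar_flip_trd_coarse:
  "c < m \<Longrightarrow> void_haar P i j k a b c (flip k m x) = void_haar P i j k a b c x"
  using neq by (simp add: void_haar_def same_cell_def flip_nth floor_digit_flip_coarse
    rademacher_digit_flip_coarse)

text \<open>After three averagings the counting part vanishes and only the volume contributes. The
  three signs in its differences cancel those of the Haar function, so the integrand has constant
  sign. Three averagings and three differences give the factor \<open>2 ^ 6\<close>; the signs
  \<open>(-1) ^ 3\<close> and that of the volume term cancel.\<close>

lemma integral_void_haar_cube_discrepancy_eq:
  fixes P :: "(real ^ 'n) set"
  assumes fin: "finite P"
  shows "(\<integral>x. void_haar P i j k a b c x * cube_discrepancy P x \<partial>cube_measure) =
    real (card P) / 2 ^ (a + b + c + 6) *
      (\<integral>x. of_bool (\<forall>p\<in>P. \<not> same_cell i j k a b c p x) * (\<Prod>l\<in>UNIV - {i, j, k}. x $ l) \<partial>cube_measure)"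
proof -
  let ?g = "void_haar P i j k a b c"
  have g: "?g \<in> borel_measurable borel" "\<And>x. \<bar>?g x\<bar> \<le> 1"
    using fin by (simp_all add: borel_measurable_void_haar abs_void_haar_le)
  have diff: "(\<integral>x. ?g x * coord_prod u x \<partial>cube_measure) =
      (\<integral>x. ?g x * coord_prod (u(i := flip_diff a (u i), j := flip_diff b (u j), k := flip_diff c (u k))) x
        \<partial>cube_measure) / 8"
    if u: "\<And>l. u l \<in> borel_measurable borel"
      and u1: "\<And>l t. 0 \<le> t \<Longrightarrow> t \<le> 1 \<Longrightarrow> \<bar>u l t\<bar> \<le> 1"
    for u :: "'n \<Rightarrow> real \<Rightarrow> real"
  proof -
    define u1 where "u1 = u(i := flip_diff a (u i))"
    define u2 where "u2 = u1(j := flip_diff b (u1 j))"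
    define u3 where "u3 = u2(k := flip_diff c (u2 k))"
    have u3: "u3 = u(i := flip_diff a (u i), j := flip_diff b (u j), k := flip_diff c (u k))"
      using neq by (auto simp: u3_def u2_def u1_def)
    note 1 = integral_coord_prod_antisymmetric[where u = u, OF g(1) u void_haar_flip_fst
        integrable_mult_coord_prod[where u = u, OF g u that(2)], folded u1_def]
    note 2 = integral_coord_prod_antisymmetric[where u = u1, OF g(1) 1(3) void_haar_flip_snd 1(2), folded u2_def]
    note 3 = integral_coord_prod_antisymmetric[where u = u2, OF g(1) 2(3) void_haar_flip_trd 2(2), folded u3_def]
    show ?thesis
      using 1(1) 2(1) 3(1) by (simp add: u3)
  qed
  have split: "coord_prod (u(i := v1, j := v2, k := v3)) x =
      v1 (x $ i) * v2 (x $ j) * v3 (x $ k) * (\<Prod>l\<in>UNIV - {i, j, k}. u l (x $ l))" for u v1 v2 v3 x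
    unfolding coord_prod_def using dist by (subst prod_UNIV_split3[OF dist]) auto
  have step: "(\<integral>x. ?g x * coord_prod (\<lambda>l t. of_bool (p $ l < t)) x \<partial>cube_measure) = 0"
    if p: "p \<in> P" for p
  proof -
    define v where "v a l = flip_diff a (\<lambda>t. of_bool (p $ l < t))" for a and l :: 'n
    \<comment> \<open>In the cell of \<open>p\<close> the Haar function is 0, and outside it one of
      the three differences is 0.\<close>
    have zero: "?g x * (v a i (x $ i) * v b j (x $ j) * v c k (x $ k) * w) = 0" for x w
    proof (cases "same_cell i j k a b c p x")
      case True
      then show ?thesis using p by (auto simp: void_haar_def)
    next
      case False
      then show ?thesis by (auto simp: same_cell_def v_def flip_diff_step_eq_0)
    qed
    have "(\<integral>x. ?g x * coord_prod (\<lambda>l t. of_bool (p $ l < t)) x \<partial>cube_measure) =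
      (\<integral>x. ?g x * coord_prod ((\<lambda>l t. of_bool (p $ l < t))(i := v a i, j := v b j, k := v c k)) x
        \<partial>cube_measure) / 8"
      unfolding v_def by (rule diff[of "\<lambda>l t. of_bool (p $ l < t)"]) auto
    also have "\<dots> = (\<integral>x. 0 \<partial>(cube_measure :: (real ^ 'n) measure)) / 8"
      by (simp only: split zero)
    finally show ?thesis
      by simp
  qed
  have ident: "(\<integral>x. ?g x * coord_prod (\<lambda>_ t. t) x \<partial>cube_measure) = - 1 / 2 ^ (a + b + c + 6) *
      (\<integral>x. of_bool (\<forall>p\<in>P. \<not> same_cell i j k a b c p x) * (\<Prod>l\<in>UNIV - {i, j, k}. x $ l) \<partial>cube_measure)"
  proof -
    have *: "?g x * coord_prod ((\<lambda>_ t. t)(i := flip_diff a (\<lambda>t. t), j := flip_diff b (\<lambda>t. t), k := flip_diff c (\<lambda>t. t))) x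
       = (- 1 / 2 ^ (a + b + c + 3)) *
        (of_bool (\<forall>p\<in>P. \<not> same_cell i j k a b c p x) * (\<Prod>l\<in>UNIV - {i, j, k}. x $ l))" for x
    proof -
      have R: "rademacher a (x $ i) * rademacher b (x $ j) * rademacher c (x $ k) *
        (flip_diff a (\<lambda>t. t) (x $ i) * flip_diff b (\<lambda>t. t) (x $ j) * flip_diff c (\<lambda>t. t) (x $ k)) =
        - 1 / 2 ^ (a + b + c + 3)"
        by (simp add: flip_diff_ident power_add rademacher_def)
      have assoc: "v * r * (e * w) = s * (v * w)" if "r * e = s" for v r e w s :: real
        unfolding that[symmetric] by (simp only: mult_ac)
      show ?thesis
        unfolding split void_haar_def by (rule assoc[OF R])
    qed
    let ?w = "\<lambda>x. of_bool (\<forall>p\<in>P. \<not> same_cell i j k a b c p x) * (\<Prod>l\<in>UNIV - {i, j, k}. x $ l)"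
    have "(\<integral>x. ?g x * coord_prod (\<lambda>_ t. t) x \<partial>cube_measure) =
      (\<integral>x. ?g x * coord_prod ((\<lambda>_ t. t)(i := flip_diff a (\<lambda>t. t), j := flip_diff b (\<lambda>t. t),
        k := flip_diff c (\<lambda>t. t))) x \<partial>cube_measure) / 8"
      by (rule diff[of "\<lambda>_ t. t"]) auto
    also have "(\<integral>x. ?g x * coord_prod ((\<lambda>_ t. t)(i := flip_diff a (\<lambda>t. t), j := flip_diff b (\<lambda>t. t),
        k := flip_diff c (\<lambda>t. t))) x \<partial>cube_measure) =
        (\<integral>x. - 1 / 2 ^ (a + b + c + 3) * ?w x \<partial>cube_measure)"
      by (intro Bochner_Integration.integral_cong refl, rule *)
    also have "\<dots> = - 1 / 2 ^ (a + b + c + 3) * (\<integral>x. ?w x \<partial>cube_measure)"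
      by (rule integral_mult_right_zero)
    finally have "(\<integral>x. ?g x * coord_prod (\<lambda>_ t. t) x \<partial>cube_measure) =
        - 1 / 2 ^ (a + b + c + 3) * (\<integral>x. ?w x \<partial>cube_measure) / 8" .
    moreover have "- 1 / 2 ^ (m + 3) * z / 8 = - 1 / 2 ^ (m + 6) * z" for m and z :: real
      by (simp add: power_add)
    ultimately show ?thesis
      by (rule trans)
  qed
  show ?thesis
    unfolding integral_mult_cube_discrepancy[OF g] ident by (simp add: step)
qed

text \<open>With \<open>d\<close> coordinates, the upper subcube \<open>H\<close> has measure at
  least \<open>1 / 2 ^ d\<close>, while the cells meeting \<open>P\<close> cover at most half of
  that. On the rest of \<open>H\<close> the product of the remaining coordinates is at least
  \<open>1 / 2 ^ d\<close>. Together with \<open>2 ^ 6\<close> this gives the exponent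
  \<open>2 * d + 7\<close>.\<close>

lemma integral_void_haar_cube_discrepancy_ge:
  fixes P :: "(real ^ 'n) set"
  assumes fin: "finite P" and N: "2 ^ (CARD('n) + 1) * card P \<le> 2 ^ (a + b + c)"
  shows "real (card P) / 2 ^ (a + b + c) / 2 ^ (2 * CARD('n) + 7)
    \<le> (\<integral>x. void_haar P i j k a b c x * cube_discrepancy P x \<partial>cube_measure)"
proof -
  let ?d = "CARD('n)"
  define V where "V = {x. \<forall>p\<in>P. \<not> same_cell i j k a b c p x}"
  define H :: "(real ^ 'n) set" where "H = {x \<in> unit_cube. \<forall>l. 1 / 2 \<le> x $ l}"
  define U where "U = (\<Union>p\<in>P. {x. same_cell i j k a b c p x})"
  have U [measurable]: "U \<in> sets borel"
    unfolding U_def using fin by (intro sets.finite_UN) auto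
  have H [measurable]: "H \<in> sets borel"
    unfolding H_def by measurable
  have VU: "V = - U" by (auto simp: V_def U_def)
  have V [measurable]: "V \<in> sets borel"
    unfolding VU by (intro borel_comp U)
  have mH: "1 / 2 ^ ?d \<le> measure cube_measure H"
  proof -
    let ?l = "(\<chi> l. 1 / 2) :: real ^ 'n" and ?u = "(\<chi> l. 1 / 2 + 1 / 2) :: real ^ 'n"
    have "ennreal (1 / 2 ^ ?d) = emeasure lborel (cbox ?l ?u)"
      by (subst emeasure_lborel_cbox_cart) (simp_all add: power_one_over)
    also have "\<dots> = emeasure lborel (box ?l ?u)"
      by (simp only: emeasure_lborel_box_eq emeasure_lborel_cbox_eq)
    also have "\<dots> \<le> emeasure lborel (unit_cube \<inter> H)"
    proof (intro emeasure_mono subsetI)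
      fix x assume "x \<in> box ?l ?u"
      then have "1 / 2 < x $ l \<and> x $ l < 1" for l
        by (simp add: mem_box_cart)
      then have "1 / 2 \<le> x $ l \<and> 0 \<le> x $ l \<and> x $ l < 1" for l
        using less_trans[of 0 "1 / 2" "x $ l"] by (simp add: less_imp_le)
      then show "x \<in> unit_cube \<inter> H"
        by (simp add: H_def unit_cube_def)
    qed simp
    also have "\<dots> = emeasure cube_measure H"
      by (rule emeasure_cube_measure[symmetric]) (rule H)
    finally show ?thesis
      by (simp add: cube.emeasure_eq_measure)
  qed
  have mU: "measure cube_measure U \<le> 1 / 2 ^ (?d + 1)"
  proof -
    have "measure cube_measure U \<le> (\<Sum>p\<in>P. measure cube_measure {x. same_cell i j k a b c p x})"
      unfolding U_def using fin by (intro cube.finite_measure_subadditive_finite) auto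
    also have "\<dots> \<le> (\<Sum>p\<in>P. 1 / 2 ^ (a + b + c))"
      unfolding same_cell_def by (intro sum_mono measure_dyadic_slab3_le dist)
    also have "\<dots> = real (card P) / 2 ^ (a + b + c)" by simp
    also have "\<dots> \<le> 1 / 2 ^ (?d + 1)"
    proof -
      have "real (2 ^ (?d + 1) * card P) \<le> real (2 ^ (a + b + c))"
        using N by (simp only: of_nat_le_iff)
      then show ?thesis by (simp add: field_simps)
    qed
    finally show ?thesis .
  qed
  have "measure cube_measure H \<le> measure cube_measure ((H \<inter> V) \<union> U)"
    by (intro cube.finite_measure_mono) (auto simp: VU)
  also have "\<dots> \<le> measure cube_measure (H \<inter> V) + measure cube_measure U"
    by (intro measure_Un_le) auto
  finally have "measure cube_measure H \<le> measure cube_measure (H \<inter> V) + measure cube_measure U" .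
  moreover have "y \<le> v" if "h \<le> v + u" "2 * y \<le> h" "u \<le> y" for h u v y :: real
    using that by linarith
  moreover have "2 * (1 / 2 ^ (?d + 1)) \<le> measure cube_measure H"
    using mH by simp
  ultimately have mHV: "1 / 2 ^ (?d + 1) \<le> measure cube_measure (H \<inter> V)"
    using mU by blast
  define I where "I = (\<integral>x. of_bool (\<forall>p\<in>P. \<not> same_cell i j k a b c p x) *
    (\<Prod>l\<in>UNIV - {i, j, k}. x $ l) \<partial>cube_measure)"
  have "(\<integral>x. 1 / 2 ^ ?d * indicator (H \<inter> V) x \<partial>cube_measure) \<le> I"
    unfolding I_def
  proof (rule integral_cube_mono)
    show "integrable cube_measure (\<lambda>x. 1 / 2 ^ ?d * indicator (H \<inter> V) x :: real)"
      by (intro integrable_mult_right) (simp add: cube.emeasure_eq_measure less_top)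
    have "(\<lambda>x. indicator V x * (\<Prod>l\<in>UNIV - {i, j, k}. x $ l) :: real) \<in> borel_measurable borel"
      by measurable
    then have meas: "(\<lambda>x. of_bool (\<forall>p\<in>P. \<not> same_cell i j k a b c p x) * (\<Prod>l\<in>UNIV - {i, j, k}. x $ l) :: real)
        \<in> borel_measurable borel"
      by (simp add: V_def indicator_def)
    have prod1: "\<bar>\<Prod>l\<in>UNIV - {i, j, k}. x $ l\<bar> \<le> 1" if "x \<in> unit_cube" for x :: "real ^ 'n"
      unfolding abs_prod using that by (intro prod_le_1) (auto simp: unit_cube_def less_imp_le)
    show "integrable cube_measure
        (\<lambda>x. of_bool (\<forall>p\<in>P. \<not> same_cell i j k a b c p x) * (\<Prod>l\<in>UNIV - {i, j, k}. x $ l))"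
      using meas prod1 by (intro integrable_cube_bounded[where B = 1]) (auto simp: abs_mult)
    fix x :: "real ^ 'n" assume x: "x \<in> unit_cube"
    show "1 / 2 ^ ?d * indicator (H \<inter> V) x
        \<le> of_bool (\<forall>p\<in>P. \<not> same_cell i j k a b c p x) * (\<Prod>l\<in>UNIV - {i, j, k}. x $ l)"
    proof (cases "x \<in> H \<inter> V")
      case True
      have "(1 / 2) ^ ?d \<le> (1 / 2 :: real) ^ card (UNIV - {i, j, k})"
        by (intro power_decreasing card_mono) auto
      also have "\<dots> = (\<Prod>l\<in>UNIV - {i, j, k}. 1 / 2)"
        by simp
      also have "\<dots> \<le> (\<Prod>l\<in>UNIV - {i, j, k}. x $ l)"
        using True by (intro prod_mono) (auto simp: H_def)
      finally show ?thesis
        using True by (simp add: V_def power_one_over)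
    next
      case False
      then show ?thesis
        using x by (auto simp: unit_cube_def intro!: prod_nonneg)
    qed
  qed
  then have "1 / 2 ^ ?d * measure cube_measure (H \<inter> V) \<le> I"
    by simp
  moreover have "1 / 2 ^ ?d * (1 / 2 ^ (?d + 1)) \<le> 1 / 2 ^ ?d * measure cube_measure (H \<inter> V)"
    by (rule mult_left_mono[OF mHV]) simp
  ultimately have "1 / 2 ^ ?d * (1 / 2 ^ (?d + 1)) \<le> I"
    by (rule order_trans[rotated])
  then have "real (card P) / 2 ^ (a + b + c + 6) * (1 / 2 ^ ?d * (1 / 2 ^ (?d + 1))) \<le>
      real (card P) / 2 ^ (a + b + c + 6) * I"
    by (rule mult_left_mono) simp
  moreover have "real (card P) / 2 ^ (a + b + c) / 2 ^ (2 * ?d + 7) =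
      real (card P) / 2 ^ (a + b + c + 6) * (1 / 2 ^ ?d * (1 / 2 ^ (?d + 1)))"
  proof -
    have *: "n / X / (Y * Y * 128) = n / (X * 64) * (1 / Y * (1 / (Y * 2)))" for n X Y :: real
      by (simp add: divide_simps)
    have d: "(2 :: real) ^ (2 * ?d + 7) = 2 ^ ?d * 2 ^ ?d * 128"
      by (simp add: power_add power_even_eq power2_eq_square)
    have m: "(2 :: real) ^ (m + 6) = 2 ^ m * 64" "(2 :: real) ^ (m + 1) = 2 ^ m * 2" for m
      by (simp_all add: power_add)
    show ?thesis
      unfolding d m by (rule *)
  qed
  ultimately show ?thesis
    unfolding integral_void_haar_cube_discrepancy_eq[OF fin] I_def by (simp only:)
qed

end

section \<open>Concentration\<close>

text \<open>Cauchy-Schwarz, by integrating \<open>2 * x * y \<le> x\<^sup>2 + y\<^sup>2\<close> with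
  a free scaling \<open>s\<close> of \<open>f\<close>. The choice \<open>s = m / A\<close> gives the
  bound; if \<open>A = 0\<close>, a large \<open>s\<close> forces \<open>m = 0\<close>.\<close>

lemma integral_abs_mult_le_sqrt:
  fixes f g :: "'a \<Rightarrow> real"
  assumes [measurable]: "f \<in> borel_measurable M" "g \<in> borel_measurable M"
    and f2: "integrable M (\<lambda>x. (f x)\<^sup>2)" and g2: "integrable M (\<lambda>x. (g x)\<^sup>2)"
  shows "(\<integral>x. \<bar>f x * g x\<bar> \<partial>M) \<le> sqrt (\<integral>x. (f x)\<^sup>2 \<partial>M) * sqrt (\<integral>x. (g x)\<^sup>2 \<partial>M)"
proof -
  define A where "A = (\<integral>x. (f x)\<^sup>2 \<partial>M)"
  define B where "B = (\<integral>x. (g x)\<^sup>2 \<partial>M)"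
  define m where "m = (\<integral>x. \<bar>f x * g x\<bar> \<partial>M)"
  have A0: "0 \<le> A" and B0: "0 \<le> B" and m0: "0 \<le> m"
    by (simp_all add: A_def B_def m_def)
  have fg: "integrable M (\<lambda>x. \<bar>f x * g x\<bar>)"
  proof (rule Bochner_Integration.integrable_bound)
    show "integrable M (\<lambda>x. (f x)\<^sup>2 + (g x)\<^sup>2)" using f2 g2 by simp
    have "\<bar>a * b\<bar> \<le> a\<^sup>2 + b\<^sup>2" for a b :: real
    proof -
      have "0 \<le> \<bar>a\<bar> * \<bar>b\<bar>" by simp
      moreover have "2 * (\<bar>a\<bar> * \<bar>b\<bar>) \<le> a\<^sup>2 + b\<^sup>2"
        using sum_squares_bound[of "\<bar>a\<bar>" "\<bar>b\<bar>"] by (simp add: mult.assoc)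
      ultimately show ?thesis
        unfolding abs_mult by linarith
    qed
    then show "AE x in M. norm \<bar>f x * g x\<bar> \<le> norm ((f x)\<^sup>2 + (g x)\<^sup>2)" by simp
  qed simp
  have quad: "2 * s * m \<le> s\<^sup>2 * A + B" for s
  proof -
    have "2 * s * m = (\<integral>x. 2 * s * \<bar>f x * g x\<bar> \<partial>M)"
      by (simp add: m_def)
    also have "\<dots> \<le> (\<integral>x. s\<^sup>2 * (f x)\<^sup>2 + (g x)\<^sup>2 \<partial>M)"
    proof (rule integral_mono)
      show "integrable M (\<lambda>x. 2 * s * \<bar>f x * g x\<bar>)" using fg by simp
      show "integrable M (\<lambda>x. s\<^sup>2 * (f x)\<^sup>2 + (g x)\<^sup>2)" using f2 g2 by simp
      fix x
      show "2 * s * \<bar>f x * g x\<bar> \<le> s\<^sup>2 * (f x)\<^sup>2 + (g x)\<^sup>2"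
        using sum_squares_bound[of "s * \<bar>f x\<bar>" "\<bar>g x\<bar>"]
        by (simp add: abs_mult power_mult_distrib mult.assoc)
    qed
    also have "\<dots> = s\<^sup>2 * A + B"
      using f2 g2 by (simp add: A_def B_def)
    finally show ?thesis .
  qed
  have "m\<^sup>2 \<le> A * B"
  proof (cases "A = 0")
    case True
    have "m = 0"
    proof (rule ccontr)
      assume "m \<noteq> 0"
      then show False using quad[of "(B + 1) / (2 * m)"] True by simp
    qed
    then show ?thesis using True by simp
  next
    case False
    then show ?thesis
      using quad[of "m / A"] A0 by (simp add: power2_eq_square field_simps)
  qed
  then show ?thesis
    using real_le_rsqrt[of m "A * B"] by (simp add: real_sqrt_mult m_def A_def B_def)
qed

lemma exp_average_le_exp_square:
  fixes y :: real
  assumes "\<bar>y\<bar> \<le> 1"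
  shows "(exp y + exp (- y)) / 2 \<le> exp (y\<^sup>2)"
proof -
  have *: "(exp z + exp (- z)) / 2 \<le> exp (z\<^sup>2)" if "0 \<le> z" "z \<le> 1" for z :: real
  proof -
    have 1: "exp z \<le> 1 + z + z\<^sup>2"
      using that by (rule exp_bound)
    \<comment> \<open>The product on the right is \<open>1 + z ^ 3\<close>.\<close>
    have "1 \<le> (1 - z + z\<^sup>2) * (1 + z)"
      using that by (simp add: algebra_simps power2_eq_square)
    also have "\<dots> \<le> (1 - z + z\<^sup>2) * exp z"
      using that exp_ge_add_one_self[of z] by (intro mult_left_mono) auto
    finally have "exp (- z) \<le> 1 - z + z\<^sup>2"
      by (simp add: exp_minus field_simps)
    then have "(exp z + exp (- z)) / 2 \<le> 1 + z\<^sup>2"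
      using 1 by simp
    also have "\<dots> \<le> exp (z\<^sup>2)"
      by (rule exp_ge_add_one_self)
    finally show ?thesis .
  qed
  show ?thesis
    using *[of y] *[of "- y"] assms by (cases "0 \<le> y") (auto simp: add.commute)
qed

text \<open>The functions \<open>g j\<close> behave like martingale differences: flipping the digit \<open>L m\<close> replaces the
  last factor \<open>exp (\<theta> * g m)\<close> by its inverse and fixes the others, so it may be averaged to a
  hyperbolic cosine.\<close>

lemma integral_exp_antisymmetric_sum_le:
  fixes g :: "nat \<Rightarrow> real ^ 'n::finite \<Rightarrow> real"
  assumes "\<And>j. j < m \<Longrightarrow> g j \<in> borel_measurable borel" "\<And>j x. j < m \<Longrightarrow> \<bar>g j x\<bar> \<le> 1"
    and "\<And>j x. j < m \<Longrightarrow> g j (flip e (L j) x) = - g j x"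
    and "\<And>j k x. k < j \<Longrightarrow> j < m \<Longrightarrow> g k (flip e (L j) x) = g k x"
    and \<theta>: "0 \<le> \<theta>" "\<theta> \<le> 1"
  shows "(\<integral>x. exp (\<theta> * (\<Sum>j<m. g j x)) \<partial>cube_measure) \<le> exp (\<theta>\<^sup>2 * real m)"
  using assms(1-4)
proof (induction m)
  case 0
  then show ?case
    using measure_cube_UNIV_le[where 'n = 'n] by simp
next
  case (Suc m)
  have meas [measurable]: "g j \<in> borel_measurable borel" if "j < Suc m" for j
    using Suc.prems(1) that .
  define G where "G x = (\<Sum>j<m. g j x)" for x
  have G [measurable]: "G \<in> borel_measurable borel"
    unfolding G_def by (intro borel_measurable_sum meas) auto
  have gm [measurable]: "g m \<in> borel_measurable borel"
    by (intro meas) auto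
  have Gb: "\<bar>G x\<bar> \<le> real m" for x
    unfolding G_def using sum_bounded_above[of "{..<m}" "\<lambda>j. \<bar>g j x\<bar>" 1] Suc.prems(2)
    by (intro order_trans[OF sum_abs]) simp
  have gb: "\<bar>g m x\<bar> \<le> 1" for x
    using Suc.prems(2) by simp
  have Gflip: "G (flip e (L m) x) = G x" for x
    unfolding G_def using Suc.prems(4) by (intro sum.cong) auto
  have gflip: "g m (flip e (L m) x) = - g m x" for x
    using Suc.prems(3) by simp
  \<comment> \<open>The values 1, -1 and 0 of \<open>\<sigma>\<close> give the original integrand,
    the flipped one, and the one without its last summand.\<close>
  have int: "integrable cube_measure (\<lambda>x. exp (\<theta> * (G x + \<sigma> * g m x)))" if "\<bar>\<sigma>\<bar> \<le> 1" for \<sigma> :: real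
  proof (rule integrable_cube_bounded)
    fix x
    have "\<bar>\<sigma> * g m x\<bar> \<le> 1"
      unfolding abs_mult using gb[of x] that by (intro mult_le_one) auto
    then have "\<bar>G x + \<sigma> * g m x\<bar> \<le> real m + 1"
      using Gb[of x] by linarith
    then have "\<bar>\<theta>\<bar> * \<bar>G x + \<sigma> * g m x\<bar> \<le> 1 * (real m + 1)"
      using \<theta> by (intro mult_mono) auto
    then have "\<theta> * (G x + \<sigma> * g m x) \<le> real m + 1"
      unfolding abs_mult[symmetric] by (metis abs_le_D1 mult_1)
    then show "\<bar>exp (\<theta> * (G x + \<sigma> * g m x))\<bar> \<le> exp (real m + 1)"
      by simp
  qed simp
  let ?I = "\<lambda>\<sigma>. \<integral>x. exp (\<theta> * (G x + \<sigma> * g m x)) \<partial>cube_measure"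
  have eq: "?I 1 = ?I (- 1)"
    using integral_flip[of "\<lambda>x. exp (\<theta> * (G x + 1 * g m x))" e "L m"] by (simp add: Gflip gflip)
  have "(\<integral>x. exp (\<theta> * (\<Sum>j<Suc m. g j x)) \<partial>cube_measure) = ?I 1"
    by (simp add: G_def)
  also have "\<dots> = (?I 1 + ?I (- 1)) / 2"
    using eq by simp
  also have "\<dots> = (\<integral>x. (exp (\<theta> * (G x + 1 * g m x)) + exp (\<theta> * (G x + (- 1) * g m x))) / 2 \<partial>cube_measure)"
    using int[of 1] int[of "- 1"] by simp
  also have "\<dots> \<le> (\<integral>x. exp (\<theta> * (G x + 0 * g m x)) * exp (\<theta>\<^sup>2) \<partial>cube_measure)"
  proof (rule integral_cube_mono)
    show "integrable cube_measure (\<lambda>x. (exp (\<theta> * (G x + 1 * g m x)) + exp (\<theta> * (G x + (- 1) * g m x))) / 2)"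
      using int[of 1] int[of "- 1"] by simp
    show "integrable cube_measure (\<lambda>x. exp (\<theta> * (G x + 0 * g m x)) * exp (\<theta>\<^sup>2))"
      by (intro integrable_mult_left int) simp
    fix x
    have abs1: "\<bar>\<theta> * g m x\<bar> \<le> 1"
      unfolding abs_mult using \<theta> gb[of x] by (intro mult_le_one) auto
    have "(\<theta> * g m x)\<^sup>2 \<le> \<theta>\<^sup>2 * 1"
      unfolding power_mult_distrib using gb[of x] abs_le_square_iff[of "g m x" 1]
      by (intro mult_left_mono) auto
    then have "(exp (\<theta> * g m x) + exp (- (\<theta> * g m x))) / 2 \<le> exp (\<theta>\<^sup>2)"
      using exp_average_le_exp_square[OF abs1] by (intro order_trans[OF exp_average_le_exp_square[OF abs1]]) simp
    then have "exp (\<theta> * G x) * ((exp (\<theta> * g m x) + exp (- (\<theta> * g m x))) / 2) \<le> exp (\<theta> * G x) * exp (\<theta>\<^sup>2)"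
      by (intro mult_left_mono) auto
    moreover have "exp (\<theta> * (G x + 1 * g m x)) = exp (\<theta> * G x) * exp (\<theta> * g m x)"
      "exp (\<theta> * (G x + (- 1) * g m x)) = exp (\<theta> * G x) * exp (- (\<theta> * g m x))"
      by (simp_all add: algebra_simps exp_add exp_diff exp_minus divide_inverse)
    ultimately show "(exp (\<theta> * (G x + 1 * g m x)) + exp (\<theta> * (G x + (- 1) * g m x))) / 2
        \<le> exp (\<theta> * (G x + 0 * g m x)) * exp (\<theta>\<^sup>2)"
      by (simp add: distrib_left)
  qed
  also have "\<dots> = (\<integral>x. exp (\<theta> * (\<Sum>j<m. g j x)) \<partial>cube_measure) * exp (\<theta>\<^sup>2)"
    by (simp add: G_def)
  also have "\<dots> \<le> exp (\<theta>\<^sup>2 * real m) * exp (\<theta>\<^sup>2)"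
    using Suc.prems by (intro mult_right_mono Suc.IH) auto
  also have "\<dots> = exp (\<theta>\<^sup>2 * real (Suc m))"
    by (simp add: distrib_left flip: exp_add)
  finally show ?case .
qed

text \<open>Chernoff bound: Markov's inequality for the exponential of \<open>\<theta>\<close> times
  the sum, with \<open>\<theta> = t / 2\<close>, the minimiser of
  \<open>\<theta>\<^sup>2 * m - \<theta> * t * m\<close>.\<close>

lemma measure_antisymmetric_sum_ge_le:
  fixes g :: "nat \<Rightarrow> real ^ 'n::finite \<Rightarrow> real"
  assumes g: "\<And>j. j < m \<Longrightarrow> g j \<in> borel_measurable borel" "\<And>j x. j < m \<Longrightarrow> \<bar>g j x\<bar> \<le> 1"
    "\<And>j x. j < m \<Longrightarrow> g j (flip e (L j) x) = - g j x"
    "\<And>j k x. k < j \<Longrightarrow> j < m \<Longrightarrow> g k (flip e (L j) x) = g k x"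
    and t: "0 < t" "t \<le> 1"
  shows "measure cube_measure {x. t * real m \<le> (\<Sum>j<m. g j x)} \<le> exp (- t\<^sup>2 * real m / 4)"
proof -
  define u where "u x = exp (t / 2 * (\<Sum>j<m. g j x))" for x
  have G [measurable]: "(\<lambda>x. \<Sum>j<m. g j x) \<in> borel_measurable borel"
    by (intro borel_measurable_sum g) auto
  have Gb: "\<bar>\<Sum>j<m. g j x\<bar> \<le> real m" for x
    using sum_bounded_above[of "{..<m}" "\<lambda>j. \<bar>g j x\<bar>" 1] g(2)
    by (intro order_trans[OF sum_abs]) simp
  have int: "integrable cube_measure u"
  proof (rule integrable_cube_bounded)
    fix x
    have "t / 2 * (\<Sum>j<m. g j x) \<le> t / 2 * real m"
      using Gb[of x] t by (intro mult_left_mono) auto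
    then show "\<bar>u x\<bar> \<le> exp (t / 2 * real m)"
      by (simp add: u_def)
  next
    show "u \<in> borel_measurable borel"
      unfolding u_def by measurable
  qed
  have "{x. t * real m \<le> (\<Sum>j<m. g j x)} = {x \<in> space cube_measure. exp (t / 2 * (t * real m)) \<le> u x}"
    using t by (auto simp: u_def)
  then have "measure cube_measure {x. t * real m \<le> (\<Sum>j<m. g j x)}
      \<le> (\<integral>x. u x \<partial>cube_measure) / exp (t / 2 * (t * real m))"
    using integral_Markov_inequality_measure[OF int, of UNIV "exp (t / 2 * (t * real m))"]
    by (simp add: u_def)
  also have "\<dots> \<le> exp ((t / 2)\<^sup>2 * real m) / exp (t / 2 * (t * real m))"
    unfolding u_def using t
    by (intro divide_right_mono integral_exp_antisymmetric_sum_le[where L = L and e = e] g) auto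
  also have "\<dots> = exp (- t\<^sup>2 * real m / 4)"
    unfolding exp_diff[symmetric] by (rule arg_cong[where f = exp]) (simp add: power2_eq_square)
  finally show ?thesis .
qed

section \<open>Expansion and size of products of factors \<open>1 + z k\<close>\<close>

lemma prod_1_plus_expand_first:
  fixes z :: "nat \<Rightarrow> 'a::comm_ring_1"
  shows "(\<Prod>k<n. 1 + z k) = 1 + (\<Sum>l<n. z l * (\<Prod>k\<in>{l<..<n}. 1 + z k))"
proof (induction n)
  case 0
  then show ?case by simp
next
  case (Suc n)
  have ins: "{l<..<Suc n} = insert n {l<..<n}" if "l < n" for l
    using that by auto
  have "(\<Sum>l<Suc n. z l * (\<Prod>k\<in>{l<..<Suc n}. 1 + z k)) =
      (\<Sum>l<n. z l * ((1 + z n) * (\<Prod>k\<in>{l<..<n}. 1 + z k))) + z n"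
  proof -
    have "{n<..<Suc n} = {}" by auto
    then show ?thesis
      by (simp add: ins)
  qed
  also have "\<dots> = (1 + z n) * (\<Sum>l<n. z l * (\<Prod>k\<in>{l<..<n}. 1 + z k)) + z n"
    by (simp add: sum_distrib_left mult_ac)
  finally show ?case
    by (simp add: Suc.IH algebra_simps)
qed

text \<open>Each product of at least two of the \<open>z k\<close> is recorded by its smallest index \<open>l\<close> and its largest
  index \<open>m\<close>; the factors in between are kept as a product, which stays bounded in the application.\<close>

lemma prod_1_plus_expand_first_last:
  fixes z :: "nat \<Rightarrow> 'a::comm_ring_1"
  shows "(\<Prod>k<n. 1 + z k) = 1 + (\<Sum>m<n. z m) +
    (\<Sum>m<n. \<Sum>l<m. z l * z m * (\<Prod>k\<in>{l<..<m}. 1 + z k))"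
proof (induction n)
  case 0
  then show ?case by simp
next
  case (Suc n)
  have "(\<Prod>k<Suc n. 1 + z k) = (\<Prod>k<n. 1 + z k) + z n * (\<Prod>k<n. 1 + z k)"
    by (simp add: algebra_simps)
  also have "z n * (\<Prod>k<n. 1 + z k) = z n + (\<Sum>l<n. z l * z n * (\<Prod>k\<in>{l<..<n}. 1 + z k))"
    by (simp add: prod_1_plus_expand_first[of z n] distrib_left sum_distrib_left mult_ac)
  finally show ?case
    by (simp add: Suc.IH)
qed

text \<open>The reason for the imaginary unit: each modulus is \<open>sqrt (1 + s\<^sup>2)\<close>,
  so the size of the product depends on the squares only and not on the sum of the
  \<open>y k\<close>.\<close>

lemma norm_prod_1_plus_imaginary_le:
  fixes y :: "'b \<Rightarrow> real"
  shows "cmod (\<Prod>k\<in>A. 1 + \<i> * of_real (y k)) \<le> exp ((\<Sum>k\<in>A. (y k)\<^sup>2) / 2)"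
proof (cases "finite A")
  case True
  have "cmod (1 + \<i> * of_real s) \<le> exp (s\<^sup>2 / 2)" for s :: real
  proof -
    have "cmod (1 + \<i> * of_real s) = sqrt (1 + s\<^sup>2)"
      by (simp add: cmod_def)
    also have "\<dots> \<le> sqrt (exp (s\<^sup>2))"
      by (intro real_sqrt_le_mono exp_ge_add_one_self)
    also have "\<dots> = exp (s\<^sup>2 / 2)"
      by (intro real_sqrt_unique) (simp_all add: power2_eq_square flip: exp_add)
    finally show ?thesis .
  qed
  then have "cmod (\<Prod>k\<in>A. 1 + \<i> * of_real (y k)) \<le> (\<Prod>k\<in>A. exp ((y k)\<^sup>2 / 2))"
    unfolding prod_norm[symmetric] by (intro prod_mono) auto
  also have "\<dots> = exp ((\<Sum>k\<in>A. (y k)\<^sup>2) / 2)"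
    using True by (simp add: exp_sum sum_divide_distrib)
  finally show ?thesis .
qed simp

section \<open>The Riesz product\<close>

text \<open>Two estimates of the integral of \<open>\<Psi> * D\<close>. From below,
  \<open>lin\<close> bounds the linear terms and \<open>quad\<close> all higher ones; from above,
  \<open>\<Psi>\<close> is bounded by \<open>exp 1\<close> off a set \<open>X\<close> that
  \<open>conc\<close> makes small. In \<open>quad\<close>, \<open>h\<close> stands for the factors
  strictly between blocks \<open>l\<close> and \<open>m\<close>, hence the condition that it be
  determined by those blocks.\<close>

lemma riesz_product_inequality:
  fixes f :: "nat \<Rightarrow> 'r \<Rightarrow> real ^ 'n::finite \<Rightarrow> real" and D :: "real ^ 'n \<Rightarrow> real"
  assumes I: "finite I" "I \<noteq> {}" and J: "0 < J"
    and D [measurable]: "D \<in> borel_measurable borel" and Db: "\<And>x. x \<in> unit_cube \<Longrightarrow> \<bar>D x\<bar> \<le> Db"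
    and fm: "\<And>j r. f j r \<in> borel_measurable borel" and fb: "\<And>j r x. \<bar>f j r x\<bar> \<le> 1"
    and lin: "\<And>j r. j < J \<Longrightarrow> r \<in> I \<Longrightarrow> c \<le> (\<integral>x. f j r x * D x \<partial>cube_measure)"
    and E: "0 \<le> E"
    and quad: "\<And>l m r s h B. l < m \<Longrightarrow> m < J \<Longrightarrow> r \<in> I \<Longrightarrow> s \<in> I \<Longrightarrow> h \<in> borel_measurable borel \<Longrightarrow>
      (\<And>x. \<bar>h x\<bar> \<le> B) \<Longrightarrow>
      (\<And>x y. (\<And>k t. l < k \<Longrightarrow> k < m \<Longrightarrow> t \<in> I \<Longrightarrow> f k t x = f k t y) \<Longrightarrow> h x = h y) \<Longrightarrow>
      \<bar>\<integral>x. f l r x * f m s x * h x * D x \<partial>cube_measure\<bar> \<le> B * E / 2 ^ (m - l)"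
    and conc: "\<And>r s. r \<in> I \<Longrightarrow> s \<in> I \<Longrightarrow> r \<noteq> s \<Longrightarrow>
      measure cube_measure {x. 1 / real (card I) * real J \<le> (\<Sum>j<J. f j r x * f j s x)}
        \<le> exp (- (1 / real (card I))\<^sup>2 * real J / 4)"
  defines "q \<equiv> real (card I)"
  shows "c * sqrt (q * real J) - q * E * exp (q / 2) \<le>
    exp 1 * (\<integral>x. \<bar>D x\<bar> \<partial>cube_measure) +
    exp (q / 2) * (q * exp (- real J / (8 * q\<^sup>2))) * sqrt (\<integral>x. (D x)\<^sup>2 \<partial>cube_measure)"
proof -
  have q1: "1 \<le> q"
    using I by (simp add: q_def Suc_leI card_gt_0_iff)
  have J1: "1 \<le> real J" using J by simp
  \<comment> \<open>With this scaling the diagonal part of the sum of all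
    \<open>(\<kappa> * F k x)\<^sup>2\<close> is at most 1, while the trivial bound for the whole
    sum is \<open>q\<close>.\<close>
  define \<kappa> where "\<kappa> = 1 / sqrt (q * real J)"
  have \<kappa>2: "\<kappa>\<^sup>2 = 1 / (q * real J)"
    using q1 J1 by (simp add: \<kappa>_def power_divide)
  have \<kappa>0: "0 \<le> \<kappa>" using q1 J1 by (simp add: \<kappa>_def)
  define F where "F j x = (\<Sum>r\<in>I. f j r x)" for j x
  have Fm [measurable]: "F j \<in> borel_measurable borel" for j
    unfolding F_def by (intro borel_measurable_sum fm)
  have Fb: "\<bar>F j x\<bar> \<le> q" for j x
    unfolding F_def q_def using sum_bounded_above[of I "\<lambda>r. \<bar>f j r x\<bar>" 1] fb
    by (intro order_trans[OF sum_abs]) simp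
  define R where "R A x = (\<Prod>k\<in>A. 1 + \<i> * of_real (\<kappa> * F k x))" for A x
  have Rm [measurable]: "R A \<in> borel_measurable borel" for A
    unfolding R_def by (intro borel_measurable_prod) simp
  have Rb: "cmod (R A x) \<le> exp ((\<Sum>k\<in>A. (F k x)\<^sup>2) / (2 * q * real J))" for A x
  proof -
    have "(\<Sum>k\<in>A. (\<kappa> * F k x)\<^sup>2) / 2 = (\<Sum>k\<in>A. (F k x)\<^sup>2) / (2 * q * real J)"
      by (simp add: power_mult_distrib \<kappa>2 sum_divide_distrib mult_ac)
    then show ?thesis
      using norm_prod_1_plus_imaginary_le[where A = A and y = "\<lambda>k. \<kappa> * F k x"] unfolding R_def by (simp only:)
  qed
  \<comment> \<open>The trivial bound, independent of \<open>J\<close>. It serves on the exceptional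
    set and for the partial products between two blocks.\<close>
  have Rb': "cmod (R A x) \<le> exp (q / 2)" if A: "A \<subseteq> {..<J}" for A x
  proof -
    have "(\<Sum>k\<in>A. (F k x)\<^sup>2) \<le> (\<Sum>k\<in>{..<J}. (F k x)\<^sup>2)"
      using A by (intro sum_mono2) auto
    also have "\<dots> \<le> (\<Sum>k\<in>{..<J}. q\<^sup>2)"
      using Fb q1 by (intro sum_mono) (simp add: abs_le_square_iff[symmetric])
    finally have "(\<Sum>k\<in>A. (F k x)\<^sup>2) / (2 * q * real J) \<le> real J * q\<^sup>2 / (2 * q * real J)"
      using q1 by (intro divide_right_mono) auto
    also have "\<dots> = q / 2"
      using q1 J1 by (simp add: power2_eq_square)
    finally show ?thesis
      using Rb[of A x] by (smt (verit) exp_le_cancel_iff)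
  qed
  \<comment> \<open>The constant term 1 is real and drops out, whereas the linear terms are purely
    imaginary and survive.\<close>
  define \<Psi> where "\<Psi> x = Im (R {..<J} x)" for x
  have \<Psi>m [measurable]: "\<Psi> \<in> borel_measurable borel"
    unfolding \<Psi>_def by (intro borel_measurable_continuous_on[OF _ Rm] continuous_intros)
  have \<Psi>b: "\<bar>\<Psi> x\<bar> \<le> exp (q / 2)" for x
    unfolding \<Psi>_def using abs_Im_le_cmod[of "R {..<J} x"] Rb'[of "{..<J}" x] by simp
  have Dint: "integrable cube_measure D"
    by (rule integrable_cube_bounded[OF D Db])
  have bint: "integrable cube_measure (\<lambda>x. v x * D x)"
    if "v \<in> borel_measurable borel" "\<And>x. \<bar>v x\<bar> \<le> b" for v :: "real ^ 'n \<Rightarrow> real" and b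
  proof (rule integrable_cube_bounded)
    show "(\<lambda>x. v x * D x) \<in> borel_measurable borel" using that(1) by simp
    fix x :: "real ^ 'n" assume "x \<in> unit_cube"
    moreover have "0 \<le> b" using that(2)[of 0] by linarith
    ultimately show "\<bar>v x * D x\<bar> \<le> b * Db"
      unfolding abs_mult using that(2) Db by (intro mult_mono) auto
  qed
  define h where "h l m x = Im (R {l<..<m} x)" for l m x
  have hm [measurable]: "h l m \<in> borel_measurable borel" for l m
    unfolding h_def by (intro borel_measurable_continuous_on[OF _ Rm] continuous_intros)
  have hb: "\<bar>h l m x\<bar> \<le> exp (q / 2)" if "m < J" for l m x
    unfolding h_def using abs_Im_le_cmod[of "R {l<..<m} x"] Rb'[of "{l<..<m}" x] that
    by (simp add: subset_eq)
  have expand: "\<Psi> x = \<kappa> * (\<Sum>m<J. F m x) - \<kappa>\<^sup>2 * (\<Sum>m<J. \<Sum>l<m. F l x * F m x * h l m x)" for x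
  proof -
    \<comment> \<open>The two outer factors contribute the real number \<open>\<i> * \<i>\<close>,
      so the imaginary part falls on the inner product alone.\<close>
    have im_term: "Im (\<i> * of_real (\<kappa> * F l x) * (\<i> * of_real (\<kappa> * F m x)) * R {l<..<m} x) =
        - (\<kappa>\<^sup>2 * (F l x * F m x * h l m x))" for l m
    proof -
      have "\<i> * of_real (\<kappa> * F l x) * (\<i> * of_real (\<kappa> * F m x)) * R {l<..<m} x =
          of_real (- (\<kappa>\<^sup>2 * (F l x * F m x))) * R {l<..<m} x"
        by (simp add: power2_eq_square algebra_simps)
      then show ?thesis
        by (simp add: h_def)
    qed
    have "\<Psi> x = Im (1 + (\<Sum>m<J. \<i> * of_real (\<kappa> * F m x)) +
      (\<Sum>m<J. \<Sum>l<m. \<i> * of_real (\<kappa> * F l x) * (\<i> * of_real (\<kappa> * F m x)) * R {l<..<m} x))"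
      unfolding \<Psi>_def R_def by (subst prod_1_plus_expand_first_last) (rule refl)
    also have "\<dots> = (\<Sum>m<J. \<kappa> * F m x) + (\<Sum>m<J. \<Sum>l<m. - (\<kappa>\<^sup>2 * (F l x * F m x * h l m x)))"
      by (simp only: plus_complex.sel Im_sum im_term) simp
    finally show ?thesis
      by (simp add: sum_distrib_left sum_negf)
  qed
  have lower: "c * sqrt (q * real J) - q * E * exp (q / 2) \<le> (\<integral>x. \<Psi> x * D x \<partial>cube_measure)"
  proof -
    define L where "L = (\<Sum>m<J. \<Sum>r\<in>I. \<integral>x. f m r x * D x \<partial>cube_measure)"
    define Q where "Q = (\<Sum>m<J. \<Sum>l<m. \<Sum>r\<in>I. \<Sum>s\<in>I.
      \<integral>x. f l r x * f m s x * h l m x * D x \<partial>cube_measure)"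
    have int1: "integrable cube_measure (\<lambda>x. f m r x * D x)" for m r
      by (rule bint[OF fm fb])
    have int2: "integrable cube_measure (\<lambda>x. f l r x * f m s x * h l m x * D x)" if "m < J" for l m r s
    proof (rule bint)
      show "(\<lambda>x. f l r x * f m s x * h l m x) \<in> borel_measurable borel"
        using fm by (intro borel_measurable_times hm)
      fix x
      have "\<bar>f l r x * f m s x\<bar> * \<bar>h l m x\<bar> \<le> (1 * 1) * exp (q / 2)"
        unfolding abs_mult using fb hb[OF that] by (intro mult_mono) auto
      then show "\<bar>f l r x * f m s x * h l m x\<bar> \<le> exp (q / 2)"
        by (simp add: abs_mult)
    qed
    have "\<Psi> x * D x = \<kappa> * (\<Sum>m<J. \<Sum>r\<in>I. f m r x * D x) -
        \<kappa>\<^sup>2 * (\<Sum>m<J. \<Sum>l<m. \<Sum>r\<in>I. \<Sum>s\<in>I. f l r x * f m s x * h l m x * D x)" for x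
    proof -
      have "F l x * F m x * h l m x * D x = (\<Sum>r\<in>I. \<Sum>s\<in>I. f l r x * f m s x * h l m x * D x)" for l m
      proof -
        have "F l x * F m x = (\<Sum>r\<in>I. \<Sum>s\<in>I. f l r x * f m s x)"
          unfolding F_def by (rule sum_product)
        then show ?thesis
          by (simp only: sum_distrib_right)
      qed
      moreover have "F m x * D x = (\<Sum>r\<in>I. f m r x * D x)" for m
        by (simp add: F_def sum_distrib_right)
      ultimately show ?thesis
        unfolding expand by (simp add: left_diff_distrib mult.assoc sum_distrib_right)
    qed
    then have "(\<integral>x. \<Psi> x * D x \<partial>cube_measure) =
        (\<integral>x. \<kappa> * (\<Sum>m<J. \<Sum>r\<in>I. f m r x * D x) -
        \<kappa>\<^sup>2 * (\<Sum>m<J. \<Sum>l<m. \<Sum>r\<in>I. \<Sum>s\<in>I. f l r x * f m s x * h l m x * D x) \<partial>cube_measure)"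
      by simp
    also have "\<dots> = \<kappa> * L - \<kappa>\<^sup>2 * Q"
    proof -
      have "(\<integral>x. (\<Sum>m<J. \<Sum>r\<in>I. f m r x * D x) \<partial>cube_measure) = L"
        unfolding L_def using int1
        by (subst Bochner_Integration.integral_sum; simp add: Bochner_Integration.integral_sum)
      moreover have "(\<integral>x. (\<Sum>m<J. \<Sum>l<m. \<Sum>r\<in>I. \<Sum>s\<in>I. f l r x * f m s x * h l m x * D x) \<partial>cube_measure) = Q"
        unfolding Q_def using int2
        by (subst Bochner_Integration.integral_sum; simp add: Bochner_Integration.integral_sum)
      moreover have "integrable cube_measure (\<lambda>x. \<Sum>m<J. \<Sum>r\<in>I. f m r x * D x)"
        "integrable cube_measure (\<lambda>x. \<Sum>m<J. \<Sum>l<m. \<Sum>r\<in>I. \<Sum>s\<in>I. f l r x * f m s x * h l m x * D x)"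
        using int1 int2 by (auto intro!: Bochner_Integration.integrable_sum)
      ultimately show ?thesis
        by simp
    qed
    finally have \<Psi>LQ: "(\<integral>x. \<Psi> x * D x \<partial>cube_measure) = \<kappa> * L - \<kappa>\<^sup>2 * Q" .
    have "c * (q * real J) = (\<Sum>m<J. \<Sum>r\<in>I. c)"
      by (simp add: q_def mult_ac)
    also have "\<dots> \<le> L"
      unfolding L_def using lin by (intro sum_mono) auto
    finally have "\<kappa> * (c * (q * real J)) \<le> \<kappa> * L"
      using \<kappa>0 by (rule mult_left_mono)
    moreover have "\<kappa> * (c * (q * real J)) = c * sqrt (q * real J)"
    proof -
      have "q * real J / sqrt (q * real J) = sqrt (q * real J)"
        using q1 J1 by (intro real_div_sqrt) auto
      then show ?thesis
        by (simp add: \<kappa>_def flip: times_divide_eq_right)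
    qed
    ultimately have LB: "c * sqrt (q * real J) \<le> \<kappa> * L"
      by simp
    \<comment> \<open>There are \<open>q\<^sup>2\<close> pairs \<open>(r, s)\<close>, and the decay
      in \<open>m - l\<close> makes the sum over \<open>l\<close> at most 1. The total is linear in
      \<open>J\<close>, and \<open>\<kappa>\<^sup>2\<close> cancels that growth.\<close>
    have "\<bar>Q\<bar> \<le> (\<Sum>m<J. \<Sum>l<m. \<Sum>r\<in>I. \<Sum>s\<in>I. exp (q / 2) * E / 2 ^ (m - l))"
      unfolding Q_def
    proof (intro order_trans[OF sum_abs] sum_mono)
      fix m l r s assume *: "m \<in> {..<J}" "l \<in> {..<m}" "r \<in> I" "s \<in> I"
      show "\<bar>\<integral>x. f l r x * f m s x * h l m x * D x \<partial>cube_measure\<bar> \<le> exp (q / 2) * E / 2 ^ (m - l)"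
      proof (rule quad)
        fix x y assume "\<And>k t. l < k \<Longrightarrow> k < m \<Longrightarrow> t \<in> I \<Longrightarrow> f k t x = f k t y"
        then have "R {l<..<m} x = R {l<..<m} y"
          unfolding R_def F_def by (intro prod.cong) auto
        then show "h l m x = h l m y"
          by (simp add: h_def)
      qed (use * hb in auto)
    qed
    also have "\<dots> = q\<^sup>2 * exp (q / 2) * E * (\<Sum>m<J. \<Sum>l<m. 1 / 2 ^ (m - l))"
      by (simp add: q_def power2_eq_square sum_distrib_left mult_ac)
    also have "\<dots> \<le> q\<^sup>2 * exp (q / 2) * E * real J"
    proof -
      have geo: "(\<Sum>l<m. 1 / 2 ^ (m - l)) \<le> (1 :: real)" for m :: nat
      proof -
        have "(\<Sum>l<m. 1 / 2 ^ (m - l)) = 1 - 1 / (2 :: real) ^ m"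
        proof (induction m)
          case (Suc m)
          have "(\<Sum>l<Suc m. 1 / 2 ^ (Suc m - l)) = (\<Sum>l<m. 1 / 2 ^ (m - l) / (2 :: real)) + 1 / 2"
            by (simp add: Suc_diff_le less_imp_le mult.commute)
          also have "\<dots> = (\<Sum>l<m. 1 / 2 ^ (m - l)) / 2 + 1 / 2"
            by (simp add: sum_divide_distrib)
          finally show ?case
            by (simp add: Suc.IH field_simps)
        qed simp
        then show ?thesis by simp
      qed
      have "(\<Sum>m<J. \<Sum>l<m. 1 / 2 ^ (m - l)) \<le> (\<Sum>m<J. 1 :: real)"
        by (intro sum_mono geo)
      then show ?thesis
        using E by (intro mult_left_mono) auto
    qed
    finally have "\<kappa>\<^sup>2 * \<bar>Q\<bar> \<le> \<kappa>\<^sup>2 * (q\<^sup>2 * exp (q / 2) * E * real J)"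
      by (intro mult_left_mono) auto
    also have "\<dots> = q * E * exp (q / 2)"
      unfolding \<kappa>2 using q1 J1 by (simp add: power2_eq_square)
    finally have "\<kappa>\<^sup>2 * Q \<le> q * E * exp (q / 2)"
      by (smt (verit) mult_left_mono zero_le_power2)
    then show ?thesis
      using LB \<Psi>LQ by linarith
  qed
  \<comment> \<open>The threshold \<open>J / q\<close> makes the off-diagonal pairs, fewer than
    \<open>q\<^sup>2\<close>, contribute at most \<open>q * J\<close> off \<open>X\<close>, which is
    also the bound for the diagonal ones. The sum of squares is then at most
    \<open>2 * q * J\<close>, whence the bound \<open>exp 1\<close>.\<close>
  define S where "S r s = {x. 1 / q * real J \<le> (\<Sum>j<J. f j r x * f j s x)}" for r s
  define X where "X = (\<Union>r\<in>I. \<Union>s\<in>I - {r}. S r s)"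
  have Sm [measurable]: "S r s \<in> sets borel" for r s
    unfolding S_def using fm by measurable
  have Xm [measurable]: "X \<in> sets borel"
    unfolding X_def using I by (intro sets.finite_UN) auto
  have mX: "measure cube_measure X \<le> q\<^sup>2 * exp (- real J / (4 * q\<^sup>2))"
  proof -
    have "measure cube_measure X \<le> (\<Sum>r\<in>I. measure cube_measure (\<Union>s\<in>I - {r}. S r s))"
      unfolding X_def using I by (intro cube.finite_measure_subadditive_finite) auto
    also have "\<dots> \<le> (\<Sum>r\<in>I. \<Sum>s\<in>I - {r}. measure cube_measure (S r s))"
      using I by (intro sum_mono cube.finite_measure_subadditive_finite) auto
    also have "\<dots> \<le> (\<Sum>r\<in>I. \<Sum>s\<in>I - {r}. exp (- real J / (4 * q\<^sup>2)))"
    proof (intro sum_mono)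
      fix r s assume "r \<in> I" "s \<in> I - {r}"
      then have "measure cube_measure (S r s) \<le> exp (- (1 / q)\<^sup>2 * real J / 4)"
        unfolding S_def q_def by (intro conc) auto
      then show "measure cube_measure (S r s) \<le> exp (- real J / (4 * q\<^sup>2))"
        by (simp add: power_divide mult.commute)
    qed
    also have "\<dots> \<le> (\<Sum>r\<in>I. \<Sum>s\<in>I. exp (- real J / (4 * q\<^sup>2)))"
      using I by (intro sum_mono sum_mono2) auto
    also have "\<dots> = q\<^sup>2 * exp (- real J / (4 * q\<^sup>2))"
      by (simp add: q_def power2_eq_square)
    finally show ?thesis .
  qed
  have \<Psi>X: "\<bar>\<Psi> x\<bar> \<le> exp 1" if "x \<notin> X" for x
  proof -
    have "(\<Sum>k<J. (F k x)\<^sup>2) = (\<Sum>k<J. \<Sum>r\<in>I. \<Sum>s\<in>I. f k r x * f k s x)"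
      by (simp add: F_def power2_eq_square sum_product)
    also have "\<dots> = (\<Sum>r\<in>I. \<Sum>s\<in>I. \<Sum>k<J. f k r x * f k s x)"
      by (simp add: sum.swap[of _ "{..<J}"])
    also have "\<dots> \<le> (\<Sum>r\<in>I. \<Sum>s\<in>I. of_bool (s = r) * real J + 1 / q * real J)"
    proof (intro sum_mono)
      fix r s assume rs: "r \<in> I" "s \<in> I"
      show "(\<Sum>k<J. f k r x * f k s x) \<le> of_bool (s = r) * real J + 1 / q * real J"
      proof (cases "s = r")
        case True
        have "f k r x * f k s x \<le> 1" for k
          using fb[of k r x] fb[of k s x] mult_le_one[of "\<bar>f k r x\<bar>" "\<bar>f k s x\<bar>"]
          by (simp add: abs_mult[symmetric])
        then have "(\<Sum>k<J. f k r x * f k s x) \<le> real J"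
          using sum_bounded_above[of "{..<J}" "\<lambda>k. f k r x * f k s x" 1] by simp
        moreover have "0 \<le> 1 / q * real J"
          using q1 by simp
        ultimately show ?thesis
          using True by simp
      next
        case False
        then show ?thesis
          using that rs by (force simp: X_def S_def not_le)
      qed
    qed
    also have "\<dots> = (\<Sum>r\<in>I. real J + real J)"
    proof (rule sum.cong[OF refl])
      fix r assume "r \<in> I"
      then have "(\<Sum>s\<in>I. of_bool (s = r) * real J) = real J"
        using I by (simp add: sum_distrib_right[symmetric])
      then show "(\<Sum>s\<in>I. of_bool (s = r) * real J + 1 / q * real J) = real J + real J"
        using q1 by (simp add: sum.distrib flip: q_def)
    qed
    also have "\<dots> = 2 * q * real J"
      by (simp add: q_def)
    finally have "(\<Sum>k<J. (F k x)\<^sup>2) / (2 * q * real J) \<le> 1"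
      using q1 J1 by (simp add: divide_le_eq)
    then have "cmod (R {..<J} x) \<le> exp 1"
      using Rb[of "{..<J}" x] by (meson exp_le_cancel_iff order_trans)
    then show ?thesis
      unfolding \<Psi>_def using abs_Im_le_cmod[of "R {..<J} x"] by simp
  qed
  have ind: "integrable cube_measure (\<lambda>x. indicator X x * \<bar>D x\<bar>)"
    using bint[of "indicator X" 1] integrable_abs[of cube_measure "\<lambda>x. indicator X x * D x"]
    by (simp add: abs_mult indicator_def)
  have "(\<integral>x. \<Psi> x * D x \<partial>cube_measure) \<le>
      (\<integral>x. exp 1 * \<bar>D x\<bar> + exp (q / 2) * (indicator X x * \<bar>D x\<bar>) \<partial>cube_measure)"
  proof (rule integral_mono)
    show "integrable cube_measure (\<lambda>x. \<Psi> x * D x)"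
      by (rule bint[OF \<Psi>m \<Psi>b])
    show "integrable cube_measure (\<lambda>x. exp 1 * \<bar>D x\<bar> + exp (q / 2) * (indicator X x * \<bar>D x\<bar>))"
      using Dint ind by simp
    fix x
    have "\<Psi> x * D x \<le> \<bar>\<Psi> x\<bar> * \<bar>D x\<bar>"
      by (metis abs_ge_self abs_mult)
    also have "\<dots> \<le> (exp 1 + exp (q / 2) * indicator X x) * \<bar>D x\<bar>"
      using \<Psi>X[of x] \<Psi>b[of x] by (intro mult_right_mono) (auto simp: indicator_def add_increasing)
    finally show "\<Psi> x * D x \<le> exp 1 * \<bar>D x\<bar> + exp (q / 2) * (indicator X x * \<bar>D x\<bar>)"
      by (simp add: distrib_right)
  qed
  also have "\<dots> = exp 1 * (\<integral>x. \<bar>D x\<bar> \<partial>cube_measure) + exp (q / 2) * (\<integral>x. indicator X x * \<bar>D x\<bar> \<partial>cube_measure)"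
    using Dint ind by simp
  finally have upper: "(\<integral>x. \<Psi> x * D x \<partial>cube_measure) \<le>
      exp 1 * (\<integral>x. \<bar>D x\<bar> \<partial>cube_measure) + exp (q / 2) * (\<integral>x. indicator X x * \<bar>D x\<bar> \<partial>cube_measure)" .
  have "(\<integral>x. indicator X x * \<bar>D x\<bar> \<partial>cube_measure) = (\<integral>x. \<bar>indicator X x * D x\<bar> \<partial>cube_measure)"
    by (simp add: abs_mult)
  also have "\<dots> \<le> sqrt (\<integral>x. (indicator X x)\<^sup>2 \<partial>cube_measure) * sqrt (\<integral>x. (D x)\<^sup>2 \<partial>cube_measure)"
  proof (rule integral_abs_mult_le_sqrt)
    have "\<bar>(D x)\<^sup>2\<bar> \<le> Db\<^sup>2" if "x \<in> unit_cube" for x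
      using Db[OF that] by (metis abs_ge_zero abs_power2 power2_abs power_mono)
    then show "integrable cube_measure (\<lambda>x. (D x)\<^sup>2)"
      by (intro integrable_cube_bounded) auto
    show "integrable cube_measure (\<lambda>x. (indicator X x :: real)\<^sup>2)"
      by (intro integrable_cube_bounded[where B = 1]) (auto simp: indicator_def)
  qed simp_all
  also have "(\<integral>x. (indicator X x)\<^sup>2 \<partial>cube_measure) = measure cube_measure X"
    by (simp add: power2_eq_square flip: indicator_inter_arith)
  \<comment> \<open>The square root halves the exponent, so 4 becomes 8, and reduces
    \<open>q\<^sup>2\<close> to \<open>q\<close>.\<close>
  also have "sqrt (measure cube_measure X) \<le> q * exp (- real J / (8 * q\<^sup>2))"
  proof (rule real_le_lsqrt)
    have "(q * exp (- real J / (8 * q\<^sup>2)))\<^sup>2 = q\<^sup>2 * exp (- real J / (4 * q\<^sup>2))"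
      by (simp add: power_mult_distrib flip: exp_double)
    then show "measure cube_measure X \<le> (q * exp (- real J / (8 * q\<^sup>2)))\<^sup>2"
      using mX by simp
  qed (use q1 in auto)
  finally have "(\<integral>x. indicator X x * \<bar>D x\<bar> \<partial>cube_measure) \<le>
      q * exp (- real J / (8 * q\<^sup>2)) * sqrt (\<integral>x. (D x)\<^sup>2 \<partial>cube_measure)"
    by (simp add: mult_right_mono)
  then have "exp (q / 2) * (\<integral>x. indicator X x * \<bar>D x\<bar> \<partial>cube_measure) \<le>
      exp (q / 2) * (q * exp (- real J / (8 * q\<^sup>2)) * sqrt (\<integral>x. (D x)\<^sup>2 \<partial>cube_measure))"
    by (rule mult_left_mono) simp
  then show ?thesis
    using lower upper unfolding mult.assoc by linarith
qed

section \<open>Application to the discrepancy function\<close>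

text \<open>One direction suffices: the \<open>L1\<close> norm is bounded above by assumption, and
  the \<open>L2\<close> norm is to be bounded below. It follows by passing from the half-open cube
  to the closed one.\<close>

lemma Lp_norm_cube_discrepancy_ge:
  fixes P :: "(real ^ 'n::finite) set"
  assumes P: "finite P" "P \<subseteq> cbox 0 1" and p: "1 \<le> p"
  shows "(\<integral>x. \<bar>cube_discrepancy P x\<bar> powr p \<partial>cube_measure) powr (1 / p)
    \<le> Lp_norm_cube p (discrepancy P)"
proof -
  let ?D = "cube_discrepancy P"
  have bound: "indicator (cbox 0 1) x *\<^sub>R (\<bar>?D x\<bar> powr p) \<le> (2 * real (card P)) powr p *\<^sub>R indicator (cbox 0 1) x"
    for x :: "real ^ 'n"
    using abs_cube_discrepancy_le[of x P] p by (auto simp: indicator_def intro!: powr_mono2)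
  have int: "integrable lborel (\<lambda>x :: real ^ 'n. indicator (cbox 0 1) x *\<^sub>R (\<bar>?D x\<bar> powr p))"
  proof (rule Bochner_Integration.integrable_bound)
    show "integrable lborel (\<lambda>x :: real ^ 'n. (2 * real (card P)) powr p *\<^sub>R indicator (cbox 0 1) x :: real)"
      using emeasure_lborel_cbox_finite[of "0 :: real ^ 'n" 1] by simp
    show "AE x in lborel. norm (indicator (cbox 0 1) x *\<^sub>R (\<bar>?D x\<bar> powr p))
        \<le> norm ((2 * real (card P)) powr p *\<^sub>R indicator (cbox 0 1) x :: real)"
      using bound by simp
  qed measurable
  have "(\<integral>x. \<bar>?D x\<bar> powr p \<partial>cube_measure) =
      (\<integral>x. indicator unit_cube x *\<^sub>R (\<bar>?D x\<bar> powr p) \<partial>lborel)"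
  proof -
    have "cube_measure = density lborel (\<lambda>x :: real ^ 'n. ennreal (indicator unit_cube x))"
      by (simp add: cube_measure_def ennreal_indicator)
    moreover have "(\<integral>x. \<bar>?D x\<bar> powr p \<partial>density lborel (\<lambda>x :: real ^ 'n. ennreal (indicator unit_cube x))) =
        (\<integral>x. indicator unit_cube x *\<^sub>R (\<bar>?D x\<bar> powr p) \<partial>lborel)"
      by (rule integral_density) auto
    ultimately show ?thesis
      by simp
  qed
  also have "\<dots> \<le> (\<integral>x. indicator (cbox 0 1) x *\<^sub>R (\<bar>?D x\<bar> powr p) \<partial>lborel)"
    using unit_cube_subset_cbox
    by (intro integral_mono'[OF int]) (auto simp: indicator_def)
  also have "\<dots> = (\<integral>x. indicator (cbox 0 1) x *\<^sub>R (\<bar>?D x\<bar> powr p) \<partial>lebesgue)"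
    by (rule integral_completion[symmetric]) measurable
  also have "\<dots> = (LINT x:cbox 0 1|lebesgue. \<bar>discrepancy P x\<bar> powr p)"
    unfolding set_lebesgue_integral_def using P
    by (intro Bochner_Integration.integral_cong) (auto simp: indicator_def discrepancy_eq_cube_discrepancy)
  finally show ?thesis
    unfolding Lp_norm_cube_def using p by (intro powr_mono2) auto
qed

lemma
  fixes P :: "(real ^ 'n::finite) set"
  assumes "finite P" "P \<subseteq> cbox 0 1"
  shows L1_norm_discrepancy_ge:
      "(\<integral>x. \<bar>cube_discrepancy P x\<bar> \<partial>cube_measure) \<le> Lp_norm_cube 1 (discrepancy P)"
    and L2_norm_discrepancy_ge:
      "sqrt (\<integral>x. (cube_discrepancy P x)\<^sup>2 \<partial>cube_measure) \<le> Lp_norm_cube 2 (discrepancy P)"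
proof -
  show "(\<integral>x. \<bar>cube_discrepancy P x\<bar> \<partial>cube_measure) \<le> Lp_norm_cube 1 (discrepancy P)"
    using Lp_norm_cube_discrepancy_ge[OF assms, of 1] by simp
  show "sqrt (\<integral>x. (cube_discrepancy P x)\<^sup>2 \<partial>cube_measure) \<le> Lp_norm_cube 2 (discrepancy P)"
    using Lp_norm_cube_discrepancy_ge[OF assms, of 2] by (simp add: powr_half_sqrt)
qed

section \<open>Test functions at the scale where \<open>2 ^ n\<close> is comparable to the number of
  points\<close>

context
  fixes i j k :: "'n::finite" and P :: "(real ^ 'n) set" and n :: nat
  assumes dist: "distinct [i, j, k]" and P: "finite P"
    and n: "2 ^ (CARD('n) + 1) * card P \<le> 2 ^ n" "2 ^ n \<le> 2 ^ (CARD('n) + 2) * card P"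
begin

text \<open>The first bound on \<open>2 ^ n\<close> leaves enough void cells; the second keeps
  \<open>card P / 2 ^ n\<close> away from 0, so the constant depends on the dimension only. Its
  exponent is \<open>(d + 2) + (2 * d + 7)\<close>.\<close>

lemma integral_void_haar_ge_const:
  assumes "a + b + c = n"
  shows "1 / 2 ^ (3 * CARD('n) + 9) \<le> (\<integral>x. void_haar P i j k a b c x * cube_discrepancy P x \<partial>cube_measure)"
proof -
  have "real (2 ^ n) \<le> real (2 ^ (CARD('n) + 2) * card P)"
    using n(2) by (simp only: of_nat_le_iff)
  then have "1 / 2 ^ (CARD('n) + 2) \<le> real (card P) / 2 ^ n"
    by (simp add: field_simps)
  then have "1 / 2 ^ (CARD('n) + 2) / 2 ^ (2 * CARD('n) + 7) \<le> real (card P) / 2 ^ n / (2 ^ (2 * CARD('n) + 7) :: real)"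
    by (rule divide_right_mono) simp
  also have "\<dots> \<le> (\<integral>x. void_haar P i j k a b c x * cube_discrepancy P x \<partial>cube_measure)"
    using integral_void_haar_cube_discrepancy_ge[OF dist P, of a b c] n(1) assms by simp
  also have "1 / 2 ^ (CARD('n) + 2) / 2 ^ (2 * CARD('n) + 7) = (1 :: real) / 2 ^ (CARD('n) + 2 + (2 * CARD('n) + 7))"
    by (simp only: power_add[symmetric] divide_divide_eq_left)
  also have "CARD('n) + 2 + (2 * CARD('n) + 7) = 3 * CARD('n) + 9"
    by simp
  finally show ?thesis .
qed

lemma integrable_cube_discrepancy_square: "integrable cube_measure (\<lambda>x. (cube_discrepancy P x)\<^sup>2)"
proof (rule integrable_cube_bounded)
  fix x :: "real ^ 'n" assume "x \<in> unit_cube"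
  then have "\<bar>cube_discrepancy P x\<bar> \<le> 2 * real (card P)"
    using unit_cube_subset_cbox by (intro abs_cube_discrepancy_le) auto
  then have "\<bar>cube_discrepancy P x\<bar>\<^sup>2 \<le> (2 * real (card P))\<^sup>2"
    by (intro power_mono) auto
  then show "\<bar>(cube_discrepancy P x)\<^sup>2\<bar> \<le> (2 * real (card P))\<^sup>2"
    by simp
qed simp

text \<open>Takes care of the bounded values of \<open>N\<close>. A single shape, here
  \<open>(n, 0, 0)\<close>, and Cauchy-Schwarz are enough.\<close>

lemma L2_discrepancy_ge_const:
  "1 / 2 ^ (3 * CARD('n) + 9) \<le> sqrt (\<integral>x. (cube_discrepancy P x)\<^sup>2 \<partial>cube_measure)"
proof -
  let ?g = "void_haar P i j k n 0 0" and ?D = "cube_discrepancy P"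
  have gm [measurable]: "?g \<in> borel_measurable borel"
    by (rule borel_measurable_void_haar[OF P])
  have gb: "(?g x)\<^sup>2 \<le> 1" for x
    using abs_void_haar_le[of P i j k n 0 0 x] by (simp add: abs_square_le_1)
  have g2: "integrable cube_measure (\<lambda>x. (?g x)\<^sup>2)"
    using gb by (intro integrable_cube_bounded[where B = 1]) auto
  have "1 / 2 ^ (3 * CARD('n) + 9) \<le> (\<integral>x. ?g x * ?D x \<partial>cube_measure)"
    by (rule integral_void_haar_ge_const) simp
  also have "\<dots> \<le> (\<integral>x. \<bar>?g x * ?D x\<bar> \<partial>cube_measure)"
    using integral_abs_bound[of cube_measure "\<lambda>x. ?g x * ?D x"] by linarith
  also have "\<dots> \<le> sqrt (\<integral>x. (?g x)\<^sup>2 \<partial>cube_measure) * sqrt (\<integral>x. (?D x)\<^sup>2 \<partial>cube_measure)"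
    by (intro integral_abs_mult_le_sqrt g2 integrable_cube_discrepancy_square) auto
  also have "\<dots> \<le> 1 * sqrt (\<integral>x. (?D x)\<^sup>2 \<partial>cube_measure)"
  proof (rule mult_right_mono)
    have "(\<integral>x. (?g x)\<^sup>2 \<partial>cube_measure) \<le> (\<integral>x. 1 \<partial>(cube_measure :: (real ^ 'n) measure))"
      using gb g2 by (intro integral_mono) auto
    also have "\<dots> \<le> 1"
      using measure_cube_UNIV_le[where 'n = 'n] by simp
    finally show "sqrt (\<integral>x. (?g x)\<^sup>2 \<partial>cube_measure) \<le> 1"
      by simp
  qed simp
  finally show ?thesis by simp
qed

lemma block_less:
  fixes K :: nat
  assumes "\<alpha> < K" "l < m"
  shows "K * l + \<alpha> < K * m + \<beta>"
proof -
  have "K * l + \<alpha> < K * (l + 1)"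
    using assms(1) by simp
  also have "\<dots> \<le> K * m"
    using assms(2) by (intro mult_le_mono2) simp
  finally show ?thesis by simp
qed

lemma discrepancy_block_inequality:
  assumes K: "0 < K" and J: "0 < J" and nJ: "K * (J + 1) \<le> n" "n \<le> K * (J + 2)"
  shows "1 / 2 ^ (3 * CARD('n) + 9) * sqrt (real (K\<^sup>2) * real J) - real (K\<^sup>2) * 2 ^ (3 * K) * exp (real (K\<^sup>2) / 2) \<le>
    exp 1 * (\<integral>x. \<bar>cube_discrepancy P x\<bar> \<partial>cube_measure) +
    exp (real (K\<^sup>2) / 2) * (real (K\<^sup>2) * exp (- real J / (8 * (real (K\<^sup>2))\<^sup>2))) *
      sqrt (\<integral>x. (cube_discrepancy P x)\<^sup>2 \<partial>cube_measure)"
proof -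
  define I where "I = {..<K} \<times> {..<K}"
  have cardI: "card I = K\<^sup>2"
    by (simp add: I_def power2_eq_square)
  \<comment> \<open>From block to block the first level rises and the third falls; the middle level
    makes up the difference to \<open>n\<close>.\<close>
  define a where "a m r = K * m + fst r" for m and r :: "nat \<times> nat"
  define c where "c m r = K * (J - 1 - m) + snd r" for m and r :: "nat \<times> nat"
  define f where "f m r = void_haar P i j k (a m r) (n - a m r - c m r) (c m r)" for m r
  \<comment> \<open>The bound \<open>K * (J + 1) \<le> n\<close> guarantees that the natural
    subtraction does not truncate.\<close>
  have sum_n: "a m r + (n - a m r - c m r) + c m r = n" if "m < J" "r \<in> I" for m r
  proof -
    have "a m r + c m r \<le> K * m + K * (J - 1 - m) + 2 * K"
      using that by (auto simp: a_def c_def I_def)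
    also have "K * m + K * (J - 1 - m) = K * (J - 1)"
      using that by (simp flip: distrib_left)
    also have "K * (J - 1) + 2 * K = K * (J + 1)"
      using J by (cases J) (simp_all add: algebra_simps)
    finally show ?thesis
      using nJ(1) by simp
  qed
  have fm: "f m r \<in> borel_measurable borel" for m r
    unfolding f_def by (rule borel_measurable_void_haar[OF P])
  have fb: "\<bar>f m r x\<bar> \<le> 1" for m r x
    unfolding f_def by (rule abs_void_haar_le)
  have a_less: "a l r < a m s" if "l < m" "r \<in> I" for l m r s
    using that block_less[of "fst r" K l m] by (auto simp: a_def I_def)
  have c_less: "c m s < c l r" if "l < m" "m < J" "s \<in> I" for l m r s
  proof -
    have "J - 1 - m < J - 1 - l" using that by linarith
    then show ?thesis
      using that block_less[of "snd s" K "J - 1 - m" "J - 1 - l"] by (auto simp: c_def I_def)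
  qed
  have flip_a: "f m s (flip i (a m s) x) = - f m s x" for m s x
    unfolding f_def by (rule void_haar_flip_fst[OF dist])
  have flip_c: "f m s (flip k (c m s) x) = - f m s x" for m s x
    unfolding f_def by (rule void_haar_flip_trd[OF dist])
  have flip_a_coarse: "f l r (flip i b x) = f l r x" if "a l r < b" for l r b x
    unfolding f_def by (rule void_haar_flip_fst_coarse[OF dist that])
  have flip_c_coarse: "f l r (flip k b x) = f l r x" if "c l r < b" for l r b x
    unfolding f_def by (rule void_haar_flip_trd_coarse[OF dist that])
  \<comment> \<open>The digit \<open>a m s\<close> of coordinate \<open>i\<close> is finer than the
    first levels in all earlier blocks, and the digit \<open>c l r\<close> of coordinate
    \<open>k\<close> finer than the third levels in all later ones. The product is therefore
    antisymmetric under both flips.\<close>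
  have quad: "\<bar>\<integral>x. f l r x * f m s x * h x * cube_discrepancy P x \<partial>cube_measure\<bar> \<le> B * 2 ^ (3 * K) / 2 ^ (m - l)"
    if lm: "l < m" "m < J" and rs: "r \<in> I" "s \<in> I" and hm: "h \<in> borel_measurable borel"
      and hb: "\<And>x. \<bar>h x\<bar> \<le> B"
      and hdep: "\<And>x y. (\<And>k t. l < k \<Longrightarrow> k < m \<Longrightarrow> t \<in> I \<Longrightarrow> f k t x = f k t y) \<Longrightarrow> h x = h y"
    for l m r s h B
  proof -
    have B0: "0 \<le> B" using hb[of 0] by linarith
    have h_a: "h (flip i (a m s) x) = h x" for x
      by (intro hdep flip_a_coarse a_less)
    have h_c: "h (flip k (c l r) x) = h x" for x
      using lm by (intro hdep flip_c_coarse c_less) auto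
    have "\<bar>\<integral>x. f l r x * f m s x * h x * cube_discrepancy P x \<partial>cube_measure\<bar> \<le>
        B * real (card P) / 2 ^ (a m s + c l r)"
    proof (rule abs_integral_antisymmetric2_le[OF P, of i k])
      show "i \<noteq> k" using dist by auto
      show "(\<lambda>x. f l r x * f m s x * h x) \<in> borel_measurable borel"
        using fm hm by (intro borel_measurable_times)
      fix x
      have "\<bar>f l r x\<bar> * \<bar>f m s x\<bar> * \<bar>h x\<bar> \<le> 1 * 1 * B"
        using fb hb B0 by (intro mult_mono) auto
      then show "\<bar>f l r x * f m s x * h x\<bar> \<le> B"
        by (simp add: abs_mult)
      show "f l r (flip i (a m s) x) * f m s (flip i (a m s) x) * h (flip i (a m s) x) = - (f l r x * f m s x * h x)"
        using a_less[OF lm(1) rs(1)] by (simp add: flip_a h_a flip_a_coarse)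
      show "f l r (flip k (c l r) x) * f m s (flip k (c l r) x) * h (flip k (c l r) x) = - (f l r x * f m s x * h x)"
        using c_less[OF lm rs(2)] by (simp add: flip_c h_c flip_c_coarse)
    qed
    also have "\<dots> \<le> B * (2 ^ (3 * K) / 2 ^ (m - l))"
    proof -
      \<comment> \<open>The two extreme levels alone nearly add up to \<open>n\<close>:
        \<open>K * (J - 1)\<close> is at least \<open>n - 3 * K\<close>, and each block between
        \<open>l\<close> and \<open>m\<close> adds \<open>K\<close>. This surplus yields the
        geometric decay.\<close>
      have level: "n + (m - l) \<le> a m s + c l r + 3 * K"
      proof -
        have "m + (J - 1 - l) = (J - 1) + (m - l)" using lm by simp
        then have "K * m + K * (J - 1 - l) = K * (J - 1) + K * (m - l)"
          by (metis distrib_left)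
        moreover have "K * (J + 2) = K * (J - 1) + 3 * K"
          using J by (cases J) (simp_all add: algebra_simps)
        moreover have "m - l \<le> K * (m - l)"
          using K by simp
        ultimately show ?thesis
          using nJ(2) unfolding a_def c_def by linarith
      qed
      have "real (card P) \<le> 2 ^ n"
      proof -
        have "card P \<le> 2 ^ (CARD('n) + 1) * card P" by simp
        then have "card P \<le> 2 ^ n" using n(1) by linarith
        then have "real (card P) \<le> real (2 ^ n)" by (simp only: of_nat_le_iff)
        then show ?thesis by simp
      qed
      then have "real (card P) * 2 ^ (m - l) \<le> 2 ^ n * 2 ^ (m - l)"
        by (rule mult_right_mono) simp
      also have "\<dots> = 2 ^ (n + (m - l))"
        by (simp add: power_add)
      also have "\<dots> \<le> (2 :: real) ^ (a m s + c l r + 3 * K)"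
        using level by (intro power_increasing) auto
      also have "\<dots> = 2 ^ (a m s + c l r) * 2 ^ (3 * K)"
        by (rule power_add)
      finally have "real (card P) / 2 ^ (a m s + c l r) \<le> 2 ^ (3 * K) / 2 ^ (m - l)"
        by (simp add: divide_simps mult.commute)
      then have "B * (real (card P) / 2 ^ (a m s + c l r)) \<le> B * (2 ^ (3 * K) / 2 ^ (m - l))"
        using B0 by (rule mult_left_mono)
      then show ?thesis by simp
    qed
    finally show ?thesis by simp
  qed
  let ?q = "real (card I)"
  have q1: "0 < 1 / ?q" "1 / ?q \<le> 1"
    using K by (simp_all add: cardI)
  \<comment> \<open>Within each block the larger first level \<open>a m s\<close> decides: its flip
    reverses the product of the pair and fixes the products of all earlier blocks.\<close>
  have conc_a: "measure cube_measure {x. 1 / ?q * real J \<le> (\<Sum>m<J. f m r x * f m s x)}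
        \<le> exp (- (1 / ?q)\<^sup>2 * real J / 4)" if rs: "r \<in> I" "s \<in> I" "fst r < fst s" for r s
  proof (rule measure_antisymmetric_sum_ge_le[where e = i and L = "\<lambda>m. a m s"])
    fix m x
    show "(\<lambda>x. f m r x * f m s x) \<in> borel_measurable borel"
      using fm by (intro borel_measurable_times)
    show "\<bar>f m r x * f m s x\<bar> \<le> 1"
      unfolding abs_mult using fb by (intro mult_le_one) auto
    show "f m r (flip i (a m s) x) * f m s (flip i (a m s) x) = - (f m r x * f m s x)"
    proof -
      have "a m r < a m s" using rs(3) by (simp add: a_def)
      then show ?thesis by (simp add: flip_a flip_a_coarse)
    qed
    fix l assume "l < m"
    then show "f l r (flip i (a m s) x) * f l s (flip i (a m s) x) = f l r x * f l s x"
      using rs by (simp add: flip_a_coarse a_less)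
  qed (use q1 in auto)
  have conc_c: "measure cube_measure {x. 1 / ?q * real J \<le> (\<Sum>m<J. f m r x * f m s x)}
        \<le> exp (- (1 / ?q)\<^sup>2 * real J / 4)" if rs: "r \<in> I" "s \<in> I" "snd r < snd s" for r s
  proof -
    \<comment> \<open>The third levels fall as \<open>m\<close> grows, so the blocks are taken in
      reverse order to obtain increasing digits.\<close>
    have "measure cube_measure {x. 1 / ?q * real J \<le> (\<Sum>m<J. f (J - Suc m) r x * f (J - Suc m) s x)}
        \<le> exp (- (1 / ?q)\<^sup>2 * real J / 4)"
    proof (rule measure_antisymmetric_sum_ge_le[where e = k and L = "\<lambda>m. c (J - Suc m) s"])
      fix m x
      show "(\<lambda>x. f (J - Suc m) r x * f (J - Suc m) s x) \<in> borel_measurable borel"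
        using fm by (intro borel_measurable_times)
      show "\<bar>f (J - Suc m) r x * f (J - Suc m) s x\<bar> \<le> 1"
        unfolding abs_mult using fb by (intro mult_le_one) auto
      let ?x = "flip k (c (J - Suc m) s) x"
      show "f (J - Suc m) r ?x * f (J - Suc m) s ?x = - (f (J - Suc m) r x * f (J - Suc m) s x)"
      proof -
        have "c (J - Suc m) r < c (J - Suc m) s" using rs(3) by (simp add: c_def)
        then show ?thesis by (simp add: flip_c flip_c_coarse)
      qed
      fix l assume "l < m" "m < J"
      then have "J - Suc m < J - Suc l" "J - Suc l < J" by auto
      then show "f (J - Suc l) r ?x * f (J - Suc l) s ?x = f (J - Suc l) r x * f (J - Suc l) s x"
        using rs by (simp add: flip_c_coarse c_less)
    qed (use q1 in auto)
    then show ?thesis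
      using sum.nat_diff_reindex[of "\<lambda>m. f m r x * f m s x" J for x] by simp
  qed
  have conc: "measure cube_measure {x. 1 / ?q * real J \<le> (\<Sum>m<J. f m r x * f m s x)}
        \<le> exp (- (1 / ?q)\<^sup>2 * real J / 4)" if rs: "r \<in> I" "s \<in> I" "r \<noteq> s" for r s
  proof -
    consider "fst r < fst s" | "fst s < fst r" | "snd r < snd s" | "snd s < snd r"
      using rs(3) by (metis linorder_neqE_nat prod_eq_iff)
    then show ?thesis
    proof cases
      case 1 then show ?thesis using conc_a rs by blast
    next
      case 2 then show ?thesis using conc_a[OF rs(2,1)] by (simp add: mult.commute)
    next
      case 3 then show ?thesis using conc_c rs by blast
    next
      case 4 then show ?thesis using conc_c[OF rs(2,1)] by (simp add: mult.commute)
    qed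
  qed
  have lin: "1 / 2 ^ (3 * CARD('n) + 9) \<le> (\<integral>x. f m r x * cube_discrepancy P x \<partial>cube_measure)"
    if "m < J" "r \<in> I" for m r
    unfolding f_def by (rule integral_void_haar_ge_const[OF sum_n[OF that]])
  have "1 / 2 ^ (3 * CARD('n) + 9) * sqrt (?q * real J) - ?q * 2 ^ (3 * K) * exp (?q / 2) \<le>
    exp 1 * (\<integral>x. \<bar>cube_discrepancy P x\<bar> \<partial>cube_measure) +
    exp (?q / 2) * (?q * exp (- real J / (8 * ?q\<^sup>2))) *
      sqrt (\<integral>x. (cube_discrepancy P x)\<^sup>2 \<partial>cube_measure)"
  proof (rule riesz_product_inequality[where f = f and Db = "2 * real (card P)"])
    show "finite I" "I \<noteq> {}" using K by (auto simp: I_def)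
    show "\<bar>cube_discrepancy P x\<bar> \<le> 2 * real (card P)" if "x \<in> unit_cube" for x
      using that unit_cube_subset_cbox by (intro abs_cube_discrepancy_le) auto
    show "0 < J" by (rule J)
    show "f m r \<in> borel_measurable borel" for m r by (rule fm)
    show "\<bar>f m r x\<bar> \<le> 1" for m r x by (rule fb)
  qed (fact borel_measurable_cube_discrepancy lin quad conc | simp)+
  then show ?thesis
    by (simp only: cardI)
qed

end

section \<open>Number of blocks and choice of the constants\<close>

lemma block_count_ge:
  fixes K n :: nat
  assumes "0 < K" "4 * K \<le> n"
  defines "J \<equiv> n div K - 1"
  shows "0 < J" "K * (J + 1) \<le> n" "n \<le> K * (J + 2)" "real n / (2 * real K) \<le> real J"
proof -
  have "4 \<le> n div K"
    using assms div_le_mono[of "4 * K" n K] by simp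
  then have J: "3 \<le> J" "n div K = J + 1"
    by (auto simp: J_def)
  show "0 < J" using J by simp
  show "K * (J + 1) \<le> n"
    unfolding J(2)[symmetric] by (rule times_div_less_eq_dividend)
  have "n < K * (J + 1) + K"
    unfolding J(2)[symmetric] using dividend_less_times_div[OF assms(1), of n] by (simp add: add.commute)
  then show le: "n \<le> K * (J + 2)"
    by simp
  have "K * (J + 2) \<le> K * (2 * J)"
    using J by (intro mult_le_mono2) simp
  then have "real n \<le> real (K * (2 * J))"
    using le by (simp only: of_nat_le_iff)
  then show "real n / (2 * real K) \<le> real J"
    using assms(1) by (simp add: field_simps)
qed

theorem theorem1p7:
  fixes C1 :: real
  assumes "CARD('n::finite) \<ge> 3" and "C1 > 0"
  shows "\<exists>C2 > 0. \<exists>c > 0. \<forall>N \<ge> 1. \<forall>P :: (real ^ 'n) set.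
           P \<subseteq> cbox 0 1 \<longrightarrow> finite P \<longrightarrow> card P = N \<longrightarrow>
           Lp_norm_cube 1 (discrepancy P) \<le> C1 * sqrt (ln (real N)) \<longrightarrow>
           Lp_norm_cube 2 (discrepancy P) \<ge> c * real N powr C2"
proof -
  obtain i j k :: 'n where dist: "distinct [i, j, k]"
  proof -
    obtain S :: "'n set" where "card S = 3"
      using obtain_subset_with_card_n[OF assms(1)] by blast
    then show ?thesis
      using that by (auto simp: card_3_iff)
  qed
  define c0 :: real where "c0 = 1 / 2 ^ (3 * CARD('n) + 9)"
  have c0: "0 < c0" by (simp add: c0_def)
  \<comment> \<open>The summand 1 leaves a spare \<open>sqrt L\<close> after the \<open>L1\<close>
    term is subtracted; this absorbs \<open>W + 1\<close>.\<close>
  define b where "b = exp 1 * C1 + 1"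
  have b: "0 < b" using assms(2) by (simp add: b_def add_pos_pos)
  \<comment> \<open>Since \<open>q = K\<^sup>2\<close> and \<open>J\<close> is at least
    \<open>L / (2 * K)\<close>, the linear terms are at least
    \<open>c0 * sqrt (K / 2) * sqrt L\<close>. This \<open>K\<close> makes that at least
    \<open>b * sqrt L\<close>.\<close>
  define K where "K = nat \<lceil>2 * (b / c0)\<^sup>2\<rceil> + 1"
  have K0: "0 < K" by (simp add: K_def)
  have "2 * (b / c0)\<^sup>2 \<le> real K"
    unfolding K_def by linarith
  then have "(b / c0)\<^sup>2 \<le> real K / 2"
    by simp
  then have "b / c0 \<le> sqrt (real K / 2)"
    by (rule real_le_rsqrt)
  then have K: "b \<le> c0 * sqrt (real K / 2)"
    using c0 by (simp add: divide_le_eq mult.commute)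
  define q where "q = real (K\<^sup>2)"
  have q1: "1 \<le> q" using K0 by (simp add: q_def)
  define W where "W = q * 2 ^ (3 * K) * exp (q / 2)"
  have W0: "0 \<le> W" using q1 by (simp add: W_def)
  define A where "A = exp (q / 2) * q"
  have A0: "0 < A" using q1 by (simp add: A_def)
  \<comment> \<open>Beyond \<open>T\<close>, \<open>sqrt L\<close> exceeds \<open>W + 1\<close> and
    \<open>n\<close> is large enough for \<open>block_count_ge\<close>.\<close>
  define T where "T = max ((W + 1)\<^sup>2) (4 * real K)"
  \<comment> \<open>The product of \<open>1 / (2 * K)\<close> from the bound on \<open>J\<close> and
    \<open>1 / (8 * q\<^sup>2)\<close> from the exponent, with
    \<open>q\<^sup>2 = K ^ 4\<close>.\<close>
  define C2 where "C2 = 1 / (16 * real K ^ 5)"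
  have C2: "0 < C2" using K0 by (simp add: C2_def)
  \<comment> \<open>The first entry is for \<open>T \<le> L\<close>, the second for the bounded
    range \<open>L < T\<close>, where the norm is at least \<open>c0\<close>.\<close>
  define c where "c = min (1 / A) (c0 * exp (- C2 * T))"
  have c: "0 < c" using A0 c0 by (simp add: c_def)
  have main: "c * real (card P) powr C2 \<le> Lp_norm_cube 2 (discrepancy P)"
    if P: "P \<subseteq> cbox 0 1" "finite P" "1 \<le> card P"
      and L1: "Lp_norm_cube 1 (discrepancy P) \<le> C1 * sqrt (ln (real (card P)))"
    for P :: "(real ^ 'n) set"
  proof -
    define N where "N = card P"
    define L where "L = ln (real N)"
    have N1: "1 \<le> N" using P by (simp add: N_def)
    have L0: "0 \<le> L" using N1 by (simp add: L_def)
    have NC2: "real N powr C2 = exp (C2 * L)"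
      using N1 by (simp add: powr_def L_def)
    obtain m where m: "2 ^ m \<le> N" "N < 2 ^ (m + 1)"
      using ex_power_ivl1[of 2 N] N1 by auto
    define n where "n = m + (CARD('n) + 2)"
    have n1: "2 ^ (CARD('n) + 1) * card P \<le> 2 ^ n"
    proof -
      have "2 ^ (CARD('n) + 1) * N \<le> 2 ^ (CARD('n) + 1) * 2 ^ (m + 1)"
        using m(2) by simp
      then show ?thesis
        by (simp add: n_def N_def power_add mult_ac)
    qed
    have n2: "2 ^ n \<le> 2 ^ (CARD('n) + 2) * card P"
      using m(1) by (simp add: n_def N_def power_add mult_ac)
    have Ln: "L \<le> real n"
    proof -
      have "L \<le> real (m + 1) * ln 2"
      proof -
        have "real N \<le> real (2 ^ (m + 1))"
          using m(2) by (simp only: of_nat_le_iff less_imp_le)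
        then have "L \<le> ln (real (2 ^ (m + 1)))"
          unfolding L_def using N1 by (subst ln_le_cancel_iff) auto
        then show ?thesis
          by (simp only: of_nat_power of_nat_numeral ln_realpow)
      qed
      also have "\<dots> \<le> real (m + 1) * 1"
        using ln_2_less_1 by (intro mult_left_mono) auto
      also have "\<dots> \<le> real n"
        by (simp add: n_def)
      finally show ?thesis .
    qed
    let ?L1 = "\<integral>x. \<bar>cube_discrepancy P x\<bar> \<partial>cube_measure"
    let ?L2 = "sqrt (\<integral>x. (cube_discrepancy P x)\<^sup>2 \<partial>cube_measure)"
    have "c * exp (C2 * L) \<le> ?L2"
    proof (cases "T \<le> L")
      case False
      have "c * exp (C2 * L) \<le> c0 * exp (- C2 * T) * exp (C2 * T)"
        using False C2 c0 by (intro mult_mono) (auto simp: c_def)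
      also have "\<dots> = c0"
        by (simp flip: exp_add)
      also have "\<dots> \<le> ?L2"
        unfolding c0_def by (rule L2_discrepancy_ge_const[OF dist P(2) n1 n2])
      finally show ?thesis .
    next
      case True
      have "4 * real K \<le> real n"
        using True Ln by (simp add: T_def)
      then have "4 * K \<le> n"
        by linarith
      note J = block_count_ge[OF K0 this]
      define J where "J = n div K - 1"
      have LJ: "L / (2 * real K) \<le> real J"
        using J(4) divide_right_mono[OF Ln, of "2 * real K"] by (simp add: J_def)
      have ineq: "c0 * sqrt (q * real J) - W \<le> exp 1 * ?L1 + A * exp (- real J / (8 * q\<^sup>2)) * ?L2"
        using discrepancy_block_inequality[OF dist P(2) n1 n2 K0 J(1-3)]
        by (simp only: c0_def q_def W_def A_def J_def mult.assoc)
      have "real K / 2 * L \<le> q * real J"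
      proof -
        have "q * (L / (2 * real K)) \<le> q * real J"
          using LJ q1 by (intro mult_left_mono) auto
        moreover have "q * (L / (2 * real K)) = real K / 2 * L"
          using K0 by (simp add: q_def power2_eq_square)
        ultimately show ?thesis by (simp only:)
      qed
      then have "sqrt (real K / 2) * sqrt L \<le> sqrt (q * real J)"
        unfolding real_sqrt_mult[symmetric] by (rule real_sqrt_le_mono)
      then have "c0 * (sqrt (real K / 2) * sqrt L) \<le> c0 * sqrt (q * real J)"
        using c0 by (intro mult_left_mono) auto
      moreover have "b * sqrt L \<le> c0 * sqrt (real K / 2) * sqrt L"
        using K L0 by (intro mult_right_mono) auto
      ultimately have lower: "b * sqrt L \<le> c0 * sqrt (q * real J)"
        by (simp add: mult.assoc)
      have "?L1 \<le> C1 * sqrt L"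
        using L1_norm_discrepancy_ge[OF P(2,1)] L1 by (simp add: L_def N_def)
      then have upper: "exp 1 * ?L1 \<le> exp 1 * (C1 * sqrt L)"
        by (intro mult_left_mono) auto
      have "(W + 1)\<^sup>2 \<le> L"
        using True by (simp add: T_def)
      then have "W + 1 \<le> sqrt L"
        by (rule real_le_rsqrt)
      moreover have "b * sqrt L = exp 1 * (C1 * sqrt L) + sqrt L"
        by (simp add: b_def distrib_right)
      \<comment> \<open>Cancelling the \<open>L1\<close> contribution leaves
        \<open>sqrt L - W\<close>, at least 1, so the exceptional set must carry at least 1.\<close>
      ultimately have one: "1 \<le> A * exp (- real J / (8 * q\<^sup>2)) * ?L2"
        using ineq lower upper by linarith
      have "C2 * L \<le> real J / (8 * q\<^sup>2)"
      proof -
        have "L / (2 * real K) / (8 * q\<^sup>2) \<le> real J / (8 * q\<^sup>2)"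
          using LJ by (rule divide_right_mono) simp
        moreover have "L / (2 * real K) / (8 * q\<^sup>2) = C2 * L"
          by (simp add: C2_def q_def eval_nat_numeral)
        ultimately show ?thesis by simp
      qed
      then have "exp (- real J / (8 * q\<^sup>2)) \<le> exp (- (C2 * L))"
        by simp
      then have "A * exp (- real J / (8 * q\<^sup>2)) * ?L2 \<le> A * exp (- (C2 * L)) * ?L2"
        using A0 by (intro mult_right_mono mult_left_mono) auto
      then have "1 \<le> A * exp (- (C2 * L)) * ?L2"
        using one by linarith
      then have "1 / A * exp (C2 * L) \<le> ?L2"
        using A0 by (simp add: exp_minus field_simps)
      moreover have "c * exp (C2 * L) \<le> 1 / A * exp (C2 * L)"
        by (intro mult_right_mono) (auto simp: c_def)
      ultimately show ?thesis
        by linarith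
    qed
    then show ?thesis
      using L2_norm_discrepancy_ge[OF P(2,1)] NC2 by (simp add: N_def)
  qed
  have "\<forall>N \<ge> 1. \<forall>P :: (real ^ 'n) set. P \<subseteq> cbox 0 1 \<longrightarrow> finite P \<longrightarrow> card P = N \<longrightarrow>
      Lp_norm_cube 1 (discrepancy P) \<le> C1 * sqrt (ln (real N)) \<longrightarrow>
      Lp_norm_cube 2 (discrepancy P) \<ge> c * real N powr C2"
    using main by blast
  then show ?thesis
    using C2 c by blast
qed

end
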